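(* Let $n\ge 1$, let $\Delta_1,\Delta_2$ be two-sided inner functions with values in $\mathbb{M}_n$ without nonconstant scalar inner factors, and suppose $D(\Delta_1)=D(\Delta_2)=\delta$, where $\delta$ is a scalar inner function. If $\theta$ is a scalar inner function and $$\text{left-g.c.d.}\{\theta I_n,\Delta_1\Delta_2\}=\text{left-g.c.d.}\{\theta I_n,\delta\Delta_1\}=\Omega,$$ then $\Omega$ has the form $\omega I_n$ for some scalar inner function $\omega$. Moreover, $\omega=\text{g.c.d.}\{\theta,\delta\}$, and $\omega^{*}\theta$ and $\delta$ are coprime.
   Context: $\mathbb{T}$ is the unit circle, $\mathbb{M}_n$ the $n\times n$ complex matrices, $H^2(\mathbb{C}^n)$ the $\mathbb{C}^n$-valued Hardy space on $\mathbb{T}$, $H^\infty(\mathbb{M}_n)=H^\infty\otimes\mathbb{M}_n$. A scalar inner function is $\theta\in H^\infty$ with $|\theta|=1$ a.e. on $\mathbb{T}$; $\theta^*=\overline{\theta}$ on $\mathbb{T}$. A two-sided inner function is $\Theta\in H^\infty(\mathbb{M}_n)$ with $\Theta(z)$ unitary for a.e. $z\in\mathbb{T}$. For scalar inner functions, $\text{g.c.d.}\{\theta_i\}$ is the inner function $\theta_d$ with $\theta_dH^2=\bigvee_i\theta_iH^2$ (closed linear span), and $\theta_1,\theta_2$ are coprime if their g.c.d. is $1$. For two-sided inner functions, $\text{left-g.c.d.}\{\Theta_i\}$ is the two-sided inner function $\Theta_{ld}$ with $\Theta_{ld}H^2(\mathbb{C}^n)=\bigvee_i\Theta_iH^2(\mathbb{C}^n)$.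 Scalar inner functions are identified up to unimodular constants; left-g.c.d.'s are unique up to a constant unitary right factor, and equality of such matrix functions is understood up to a constant unitary right factor. A scalar inner function $\theta$ is a scalar inner factor of $\Theta$ if $\Theta=\theta\Psi$ for some $\Psi\in H^\infty(\mathbb{M}_n)$; "$\Theta$ has no nonconstant scalar inner factors" means every scalar inner factor is constant. A scalar inner function $\theta$ is a scalar inner multiple of a two-sided inner $\Theta$ if there is $\Delta\in H^\infty(\mathbb{M}_n)$ with $\Theta\Delta=\Delta\Theta=\theta I_n$. $D(\Theta)$, the minimal scalar inner multiple, is the g.c.d. of all scalar inner multiples of $\Theta$ (it always exists and is itself a scalar inner multiple of $\Theta$). *)

theory Defs
  imports "HOL-Analysis.Analysis"
begin

text \<open>
  Functions on the unit circle are total functions on \<open>complex\<close> that matter only up to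
  equality almost everywhere with respect to \<open>arc_measure\<close>, the normalised arc length measure,
  which is concentrated on the circle. All subspaces of \<open>L2\<close> below are closed
  under almost everywhere equality, so that equality of such sets is equality of subspaces of the
  usual quotient space.
\<close>

definition arc_measure :: "complex measure" where
  "arc_measure = distr (uniform_measure lborel {0..2 * pi}) borel cis"

definition L2 :: "(complex \<Rightarrow> 'a::euclidean_space) set" where
  "L2 = {f \<in> borel_measurable borel. integrable arc_measure (\<lambda>z. (norm (f z))\<^sup>2)}"

definition L2_dist :: "(complex \<Rightarrow> 'a::euclidean_space) \<Rightarrow> (complex \<Rightarrow> 'a) \<Rightarrow> real" where
  "L2_dist f g = sqrt (LINT z|arc_measure. (norm (f z - g z))\<^sup>2)"

text \<open>
  On the circle \<open>z ^ k\<close> is the complex conjugate of \<open>z powi (- k)\<close>, so the integral in the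
  definition of \<open>H2\<close> is the Fourier coefficient of \<open>f\<close> of index \<open>- k\<close>.
\<close>

definition H2 :: "(complex \<Rightarrow> complex) set" where
  "H2 = {f \<in> L2. \<forall>k\<ge>1. (LINT z|arc_measure. f z * z ^ k) = 0}"

definition H2_vec :: "(complex \<Rightarrow> complex ^ 'n) set" where
  "H2_vec = {f. \<forall>i. (\<lambda>z. f z $ i) \<in> H2}"

definition Hinf :: "(complex \<Rightarrow> complex) set" where
  "Hinf = {f \<in> H2. \<exists>C. AE z in arc_measure. norm (f z) \<le> C}"

definition Hinf_mat :: "(complex \<Rightarrow> complex ^ 'n ^ 'n) set" where
  "Hinf_mat = {F. \<forall>i j. (\<lambda>z. F z $ i $ j) \<in> Hinf}"

definition adjoint_mat :: "complex ^ 'n ^ 'n \<Rightarrow> complex ^ 'n ^ 'n" where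
  "adjoint_mat A = (\<chi> i j. cnj (A $ j $ i))"

definition unitary_mat :: "complex ^ 'n ^ 'n \<Rightarrow> bool" where
  "unitary_mat A \<longleftrightarrow> A ** adjoint_mat A = mat 1 \<and> adjoint_mat A ** A = mat 1"

definition scalar_inner :: "(complex \<Rightarrow> complex) \<Rightarrow> bool" where
  "scalar_inner \<theta> \<longleftrightarrow> \<theta> \<in> Hinf \<and> (AE z in arc_measure. norm (\<theta> z) = 1)"

definition two_sided_inner :: "(complex \<Rightarrow> complex ^ 'n ^ 'n) \<Rightarrow> bool" where
  "two_sided_inner \<Theta> \<longleftrightarrow> \<Theta> \<in> Hinf_mat \<and> (AE z in arc_measure. unitary_mat (\<Theta> z))"

text \<open>
  Closed complex linear span in \<open>L2\<close>, for generators in \<open>L2\<close>. The complex scalar multiplication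
  \<open>sc\<close> on the value space is a parameter, to be instantiated by \<open>(*)\<close> on \<open>complex\<close> and by \<open>(*s)\<close>
  on \<open>complex ^ 'n\<close>.
\<close>

definition lin_span ::
  "(complex \<Rightarrow> 'a \<Rightarrow> 'a) \<Rightarrow> (complex \<Rightarrow> 'a::euclidean_space) set \<Rightarrow> (complex \<Rightarrow> 'a) set" where
  "lin_span sc S = {(\<lambda>z. \<Sum>g\<in>T. sc (c g) (g z)) | T c. finite T \<and> T \<subseteq> S}"

definition closed_span ::
  "(complex \<Rightarrow> 'a \<Rightarrow> 'a) \<Rightarrow> (complex \<Rightarrow> 'a::euclidean_space) set \<Rightarrow> (complex \<Rightarrow> 'a) set" where
  "closed_span sc S = {f \<in> L2. \<forall>e>0. \<exists>g\<in>lin_span sc S. L2_dist f g < e}"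

definition scalar_range :: "(complex \<Rightarrow> complex) \<Rightarrow> (complex \<Rightarrow> complex) set" where
  "scalar_range \<theta> = {f \<in> L2. \<exists>h\<in>H2. AE z in arc_measure. f z = \<theta> z * h z}"

definition mat_range :: "(complex \<Rightarrow> complex ^ 'n ^ 'n) \<Rightarrow> (complex \<Rightarrow> complex ^ 'n) set" where
  "mat_range \<Theta> = {f \<in> L2. \<exists>h\<in>H2_vec. AE z in arc_measure. f z = \<Theta> z *v h z}"

text \<open>
  Greatest common divisors are relations, since they are determined only up to a unimodular
  constant and up to a constant unitary right factor, respectively.
\<close>

definition is_gcd :: "(complex \<Rightarrow> complex) set \<Rightarrow> (complex \<Rightarrow> complex) \<Rightarrow> bool" where
  "is_gcd S d \<longleftrightarrow>
     scalar_inner d \<and> scalar_range d = closed_span (*) (\<Union>\<theta>\<in>S. scalar_range \<theta>)"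

definition is_left_gcd ::
  "(complex \<Rightarrow> complex ^ 'n ^ 'n) set \<Rightarrow> (complex \<Rightarrow> complex ^ 'n ^ 'n) \<Rightarrow> bool" where
  "is_left_gcd S \<Omega> \<longleftrightarrow>
     two_sided_inner \<Omega> \<and> mat_range \<Omega> = closed_span (*s) (\<Union>\<Theta>\<in>S. mat_range \<Theta>)"

definition coprime_inner :: "(complex \<Rightarrow> complex) \<Rightarrow> (complex \<Rightarrow> complex) \<Rightarrow> bool" where
  "coprime_inner \<theta>\<^sub>1 \<theta>\<^sub>2 \<longleftrightarrow>
     scalar_inner \<theta>\<^sub>1 \<and> scalar_inner \<theta>\<^sub>2 \<and> is_gcd {\<theta>\<^sub>1, \<theta>\<^sub>2} (\<lambda>z. 1)"

definition scalar_inner_factor ::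
  "(complex \<Rightarrow> complex) \<Rightarrow> (complex \<Rightarrow> complex ^ 'n ^ 'n) \<Rightarrow> bool" where
  "scalar_inner_factor \<theta> \<Theta> \<longleftrightarrow>
     scalar_inner \<theta> \<and> (\<exists>\<Psi>\<in>Hinf_mat. AE z in arc_measure. \<Theta> z = mat (\<theta> z) ** \<Psi> z)"

definition no_nonconstant_scalar_inner_factors :: "(complex \<Rightarrow> complex ^ 'n ^ 'n) \<Rightarrow> bool" where
  "no_nonconstant_scalar_inner_factors \<Theta> \<longleftrightarrow>
     (\<forall>\<theta>. scalar_inner_factor \<theta> \<Theta> \<longrightarrow> (\<exists>c. AE z in arc_measure. \<theta> z = c))"

definition scalar_inner_multiple ::
  "(complex \<Rightarrow> complex) \<Rightarrow> (complex \<Rightarrow> complex ^ 'n ^ 'n) \<Rightarrow> bool" where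
  "scalar_inner_multiple \<theta> \<Theta> \<longleftrightarrow>
     scalar_inner \<theta> \<and>
     (\<exists>\<Delta>\<in>Hinf_mat. AE z in arc_measure.
        \<Theta> z ** \<Delta> z = mat (\<theta> z) \<and> \<Delta> z ** \<Theta> z = mat (\<theta> z))"

definition is_minimal_scalar_inner_multiple ::
  "(complex \<Rightarrow> complex ^ 'n ^ 'n) \<Rightarrow> (complex \<Rightarrow> complex) \<Rightarrow> bool" where
  "is_minimal_scalar_inner_multiple \<Theta> \<delta> \<longleftrightarrow> is_gcd {\<theta>. scalar_inner_multiple \<theta> \<Theta>} \<delta>"

end

theory Submission
  imports Defs "HOL-Probability.Probability_Measure"
begin

text \<open>
  Beurling's theorem, applied to closed spans of ranges of scalar inner functions, provides
  \<open>\<omega> = gcd {\<theta>, \<delta>}\<close> and \<open>\<sigma> = gcd {\<omega>\<^sup>*\<theta>, \<delta>}\<close>. Everything else is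
  division: a bounded multiplier that maps the generators of a closed span into \<open>H\<^sup>2\<close> maps the whole
  span into \<open>H\<^sup>2\<close>. The multiplier \<open>\<omega>\<^sup>*\<sigma>\<^sup>*\<delta>\<Delta>\<^sub>1\<^sup>*\<close> does so for \<open>\<theta>I\<close> and
  \<open>\<delta>\<Delta>\<^sub>1\<close>, hence \<open>\<omega>\<^sup>*\<sigma>\<^sup>*\<delta>\<Delta>\<^sub>2\<close> is analytic; since \<open>\<omega>\<close> is spanned by \<open>\<theta>\<close> and
  \<open>\<delta>\<close>, already \<open>\<sigma>\<^sup>*\<Delta>\<^sub>2\<close> is analytic. So \<open>\<sigma>\<close> is a scalar inner factor of \<open>\<Delta>\<^sub>2\<close>
  and therefore constant, which is the coprimality of \<open>\<omega>\<^sup>*\<theta>\<close> and \<open>\<delta>\<close>. It follows that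
  \<open>\<omega>\<^sup>*\<Omega>\<close> and its adjoint are both analytic, that is, \<open>\<omega>\<^sup>*\<Omega>\<close> is constant.
\<close>

section \<open>Arc length measure and uniqueness of Fourier coefficients\<close>

text \<open>The obstacle is a square. The scalars that \<open>\<Omega>\<close> visibly divides are
  \<open>\<theta>\<close> and, because \<open>\<delta>\<Delta>\<^sub>1\<close> times
  \<open>\<delta>\<Delta>\<^sub>1\<^sup>*\<close> is \<open>\<delta>\<^sup>2I\<close>, the square of
  \<open>\<delta>\<close>. With \<open>\<delta>' = \<omega>\<^sup>*\<delta>\<close> their g.c.d. is
  \<open>\<omega>\<close> times the g.c.d. of \<open>\<omega>\<^sup>*\<theta>\<close> and
  \<open>\<delta>\<delta>'\<close>. Coprimality of \<open>\<omega>\<^sup>*\<theta>\<close> with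
  \<open>\<delta>'\<close> is automatic, but the scalar data alone do not prevent a common factor
  \<open>\<sigma>\<close> with \<open>\<delta>\<close>, and such a factor could separate
  \<open>\<Omega>\<close> from \<open>\<omega>\<close>. Hence coprimality with
  \<open>\<delta>\<close> itself comes before any statement about \<open>\<Omega>\<close>. Its proof
  joins the two descriptions of \<open>\<Omega>\<close>: one supplies the generators
  \<open>\<theta>I\<close> and \<open>\<delta>\<Delta>\<^sub>1\<close>, the other places
  \<open>\<Delta>\<^sub>1\<Delta>\<^sub>2\<close> in their span. The multiplier must cancel
  \<open>\<Delta>\<^sub>1\<close> on the left, and \<open>\<delta>\<Delta>\<^sub>1\<^sup>*\<close>
  is an analytic way to do so. On \<open>\<delta>\<Delta>\<^sub>1\<close> it again leaves a square
  of \<open>\<delta>\<close>, now welcome: one factor absorbs \<open>\<omega>\<close>, the other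
  \<open>\<sigma>\<close>, although \<open>\<omega>\<sigma>\<close> need not divide
  \<open>\<delta>\<close>.\<close>

lemma sets_arc_measure [simp, measurable_cong]: "sets arc_measure = sets borel"
  and space_arc_measure [simp]: "space arc_measure = UNIV"
  by (simp_all add: arc_measure_def)

lemma cis_borel_measurable [measurable]: "cis \<in> borel_measurable borel"
  by (intro borel_measurable_continuous_onI continuous_intros)

interpretation arc: prob_space arc_measure
  unfolding arc_measure_def
  by (intro prob_space.prob_space_distr prob_space_uniform_measure) auto

lemma measure_arc_UNIV [simp]: "measure arc_measure UNIV = 1"
  using arc.prob_space by simp

lemma AE_arc_norm: "AE z in arc_measure. norm z = 1"
  unfolding arc_measure_def by (subst AE_distr_iff) auto

lemma AE_arc_mult_cnj: "AE z in arc_measure. z * cnj z = 1"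
  using AE_arc_norm by eventually_elim (simp add: complex_norm_square[symmetric])

lemma integral_arc_measure:
  fixes f :: "complex \<Rightarrow> complex"
  assumes "continuous_on UNIV f"
  shows "(LINT z|arc_measure. f z)
    = (LINT t|lborel. indicator {0..2*pi} t *\<^sub>R (f (cis t) / (2 * pi)))"
proof -
  have [measurable]: "f \<in> borel_measurable borel"
    by (rule borel_measurable_continuous_onI[OF assms])
  have *: "uniform_measure lborel {0..2*pi}
    = density lborel (\<lambda>t. ennreal (indicator {0..2*pi} t / (2 * pi)))"
    unfolding uniform_measure_def
    by (intro density_cong) (auto simp: indicator_def divide_ennreal[symmetric])
  have "(LINT z|arc_measure. f z) = (LINT t|uniform_measure lborel {0..2*pi}. f (cis t))"
    unfolding arc_measure_def by (subst integral_distr) auto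
  also have "\<dots> = (LINT t|lborel. (indicator {0..2*pi} t / (2 * pi)) *\<^sub>R f (cis t))"
    unfolding * by (subst integral_density) auto
  also have "\<dots> = (LINT t|lborel. indicator {0..2*pi} t *\<^sub>R (f (cis t) / (2 * pi)))"
    by (intro Bochner_Integration.integral_cong) (auto simp: indicator_def scaleR_conv_of_real)
  finally show ?thesis .
qed

lemma integral_arc_power:
  assumes "k \<ge> 1"
  shows "(LINT z|arc_measure. z ^ k) = 0"
proof -
  \<comment> \<open>\<open>F\<close> is an antiderivative of the integrand; it exists because k is
    nonzero, and it has period 2 pi.\<close>
  define F where "F t = cis (real k * t) / (\<i> * of_nat k * of_real (2 * pi))" for t
  have "(LINT z|arc_measure. z ^ k)
    = (LINT t|lborel. indicator {0..2*pi} t *\<^sub>R (cis (real k * t) / of_real (2 * pi)))"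
    by (subst integral_arc_measure) (auto intro!: continuous_intros simp: Complex.DeMoivre)
  also have "\<dots> = F (2 * pi) - F 0"
  proof (rule integral_FTC_Icc)
    show "(F has_vector_derivative cis (real k * t) / of_real (2 * pi)) (at t within {0..2*pi})" for t
      unfolding F_def cis_conv_exp using assms
      by (auto intro!: derivative_eq_intros has_vector_derivative_real_field simp: field_simps)
  qed (auto intro!: continuous_intros)
  also have "\<dots> = 0"
    using cis_multiple_2pi[of "real k"] by (simp add: F_def mult_ac)
  finally show ?thesis .
qed

section \<open>Uniqueness of Fourier coefficients for integrable functions\<close>

lemma borel_measurable_cnj [measurable]: "cnj \<in> borel_measurable borel"
  by (intro borel_measurable_continuous_onI continuous_intros)

lemma integrable_mult_bounded:
  fixes f g :: "complex \<Rightarrow> complex"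
  assumes f: "integrable arc_measure f" and g [measurable]: "g \<in> borel_measurable borel"
    and bd: "AE z in arc_measure. norm (g z) \<le> C"
  shows "integrable arc_measure (\<lambda>z. f z * g z)"
proof (rule Bochner_Integration.integrable_bound)
  show "integrable arc_measure (\<lambda>z. C *\<^sub>R f z)" using f by simp
  have [measurable]: "f \<in> borel_measurable borel" using borel_measurable_integrable[OF f] by simp
  show "(\<lambda>z. f z * g z) \<in> borel_measurable arc_measure" by measurable
  show "AE z in arc_measure. norm (f z * g z) \<le> norm (C *\<^sub>R f z)"
    using bd
  proof eventually_elim
    case (elim z)
    have "norm (f z) * norm (g z) \<le> norm (f z) * C" using elim by (intro mult_left_mono) auto
    also have "\<dots> \<le> norm (f z) * \<bar>C\<bar>" by (intro mult_left_mono) auto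
    finally show ?case by (simp add: norm_mult mult_ac)
  qed
qed

lemma integrable_mult_power:
  assumes "integrable arc_measure f"
  shows "integrable arc_measure (\<lambda>z. f z * z ^ k)" "integrable arc_measure (\<lambda>z. f z * cnj z ^ k)"
  using AE_arc_norm
  by (auto intro!: integrable_mult_bounded[OF assms, where C=1] simp: norm_power elim!: eventually_mono)

text \<open>Integrability replaces square integrability because uniqueness is later applied to the
  squared modulus of an \<open>L2\<close> function. On the circle the two families of powers
  together exhaust all integer frequencies.\<close>

definition zero_coeffs :: "(complex \<Rightarrow> complex) \<Rightarrow> bool" where
  "zero_coeffs f \<longleftrightarrow> integrable arc_measure f \<and>
     (\<forall>k. (LINT z|arc_measure. f z * z ^ k) = 0 \<and> (LINT z|arc_measure. f z * cnj z ^ k) = 0)"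

lemma zero_coeffs_add:
  "zero_coeffs f \<Longrightarrow> zero_coeffs g \<Longrightarrow> zero_coeffs (\<lambda>z. f z + g z)"
  by (simp add: zero_coeffs_def ring_distribs integrable_mult_power)

lemma zero_coeffs_cmult: "zero_coeffs f \<Longrightarrow> zero_coeffs (\<lambda>z. f z * c)"
  using integral_mult_left_zero[of arc_measure "\<lambda>z. f z * z ^ _" c]
    integral_mult_left_zero[of arc_measure "\<lambda>z. f z * cnj z ^ _" c]
  by (simp add: zero_coeffs_def mult_ac)

text \<open>On the circle \<open>cnj z\<close> is the inverse of \<open>z\<close>, so either
  multiplication shifts the coefficient sequence by one. The case \<open>k = 0\<close> is the index
  that crosses over to the other family.\<close>

lemma zero_coeffs_shift:
  assumes f: "zero_coeffs f"
  shows "zero_coeffs (\<lambda>z. f z * z)" "zero_coeffs (\<lambda>z. f z * cnj z)"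
proof -
  have int: "integrable arc_measure f" using f by (simp add: zero_coeffs_def)
  have [measurable]: "f \<in> borel_measurable borel" using borel_measurable_integrable[OF int] by simp
  have 1: "(LINT z|arc_measure. f z * z * cnj z ^ k) = 0" for k
  proof (cases k)
    case 0 then show ?thesis using f by (auto simp: zero_coeffs_def dest: spec[of _ 1])
  next
    case (Suc j)
    have "(LINT z|arc_measure. f z * z * cnj z ^ k) = (LINT z|arc_measure. f z * cnj z ^ j)"
      by (rule integral_cong_AE, measurable, use AE_arc_mult_cnj in eventually_elim)
        (simp add: Suc mult_ac)
    then show ?thesis using f by (simp add: zero_coeffs_def)
  qed
  have 2: "(LINT z|arc_measure. f z * cnj z * z ^ k) = 0" for k
  proof (cases k)
    case 0 then show ?thesis using f by (auto simp: zero_coeffs_def dest: spec[of _ 1])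
  next
    case (Suc j)
    have "(LINT z|arc_measure. f z * cnj z * z ^ k) = (LINT z|arc_measure. f z * z ^ j)"
      by (rule integral_cong_AE, measurable, use AE_arc_mult_cnj in eventually_elim)
        (simp add: Suc mult_ac)
    then show ?thesis using f by (simp add: zero_coeffs_def)
  qed
  show "zero_coeffs (\<lambda>z. f z * z)"
    using integrable_mult_power(1)[OF int, of 1] 1 f
    by (auto simp: zero_coeffs_def mult.assoc power_Suc[symmetric] simp del: power_Suc)
  show "zero_coeffs (\<lambda>z. f z * cnj z)"
    using integrable_mult_power(2)[OF int, of 1] 2 f
    by (auto simp: zero_coeffs_def mult.assoc power_Suc[symmetric] simp del: power_Suc)
qed

text \<open>A real polynomial on the plane is a polynomial in \<open>z\<close> and
  \<open>cnj z\<close>, so repeated shifts suffice. \<open>f\<close> is arbitrary in the induction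
  because a product is treated by multiplying with one factor after the other.\<close>

lemma zero_coeffs_polynomial:
  assumes "real_polynomial_function p"
  shows "zero_coeffs f \<Longrightarrow> zero_coeffs (\<lambda>z. f z * of_real (p z))"
  using assms
proof (induction p arbitrary: f rule: real_polynomial_function.induct)
  case (linear p)
  interpret bounded_linear p by fact
  \<comment> \<open>The derivative of \<open>p\<close> with respect to \<open>z\<close>: a
    real-linear functional on the plane is twice the real part of \<open>c * z\<close>.\<close>
  define c where "c = (of_real (p 1) - \<i> * of_real (p \<i>)) / 2"
  have p: "complex_of_real (p z) = z * c + cnj z * cnj c" for z
  proof -
    have "p z = p (Re z *\<^sub>R 1 + Im z *\<^sub>R \<i>)" by (simp add: scaleR_conv_of_real complex_eq[symmetric] mult.commute)
    also have "\<dots> = Re z * p 1 + Im z * p \<i>" by (simp only: add scaleR) simp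
    finally show ?thesis by (auto simp: complex_eq_iff c_def field_simps)
  qed
  show ?case
    unfolding p using zero_coeffs_add[OF zero_coeffs_cmult[OF zero_coeffs_shift(1)[OF linear.prems]]
      zero_coeffs_cmult[OF zero_coeffs_shift(2)[OF linear.prems]], of c "cnj c"]
    by (simp add: algebra_simps)
next
  case (const c) then show ?case by (intro zero_coeffs_cmult)
next
  case (add p q)
  then show ?case using zero_coeffs_add by (simp add: algebra_simps)
next
  case (mult p q)
  from mult.IH(2)[OF mult.IH(1)[OF mult.prems]] show ?case by (simp add: mult.assoc)
qed

text \<open>Stone-Weierstrass approximates \<open>g\<close> uniformly on the unit circle, which
  carries the measure, and a uniform error \<open>e\<close> costs at most \<open>e\<close> times the
  L1 norm of \<open>f\<close>.\<close>

lemma zero_coeffs_continuous: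
  fixes g :: "complex \<Rightarrow> real"
  assumes f: "zero_coeffs f" and g: "continuous_on UNIV g"
  shows "(LINT z|arc_measure. f z * of_real (g z)) = 0"
proof -
  have int: "integrable arc_measure f" using f by (simp add: zero_coeffs_def)
  have [measurable]: "g \<in> borel_measurable borel" by (rule borel_measurable_continuous_onI[OF g])
  have gS: "continuous_on (sphere 0 1) g" using g continuous_on_subset by blast
  have "bounded (g ` sphere 0 1)" using gS by (intro compact_imp_bounded compact_continuous_image) auto
  then obtain B where B: "\<And>z. norm z = 1 \<Longrightarrow> \<bar>g z\<bar> \<le> B" by (force simp: bounded_iff)
  have intg: "integrable arc_measure (\<lambda>z. f z * of_real (g z))"
    using AE_arc_norm by (intro integrable_mult_bounded[OF int, where C=B]) (auto elim!: eventually_mono intro: B)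
  define I where "I = (LINT z|arc_measure. norm (f z))"
  have I: "I \<ge> 0" by (simp add: I_def)
  have "norm (LINT z|arc_measure. f z * of_real (g z)) \<le> e * I" if e: "e > 0" for e
  proof -
    obtain p where p: "real_polynomial_function p" "\<And>z. z \<in> sphere 0 1 \<Longrightarrow> \<bar>g z - p z\<bar> < e"
      using Stone_Weierstrass_real_polynomial_function[OF compact_sphere gS e] by blast
    have z: "zero_coeffs (\<lambda>z. f z * of_real (p z))" by (rule zero_coeffs_polynomial[OF p(1) f])
    then have intp: "integrable arc_measure (\<lambda>z. f z * of_real (p z))"
      and "(LINT z|arc_measure. f z * of_real (p z)) = 0"
      by (auto simp: zero_coeffs_def dest: spec[of _ 0])
    then have "(LINT z|arc_measure. f z * of_real (g z))
      = (LINT z|arc_measure. f z * of_real (g z) - f z * of_real (p z))" using intg by simp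
    also have "norm \<dots> \<le> (LINT z|arc_measure. norm (f z * of_real (g z) - f z * of_real (p z)))"
      by (rule integral_norm_bound)
    also have "\<dots> \<le> (LINT z|arc_measure. e * norm (f z))"
    proof (rule integral_mono_AE)
      show "AE z in arc_measure. norm (f z * of_real (g z) - f z * of_real (p z)) \<le> e * norm (f z)"
        using AE_arc_norm
      proof eventually_elim
        case (elim z)
        have "norm (f z * of_real (g z) - f z * of_real (p z)) = norm (f z) * \<bar>g z - p z\<bar>"
          by (metis norm_mult norm_of_real of_real_diff right_diff_distrib)
        then show ?case using p(2)[of z] elim mult_left_mono[of "\<bar>g z - p z\<bar>" e "norm (f z)"]
            by (simp add: mult.commute)
      qed
    qed (use int intg intp in auto)
    finally show ?thesis by (simp add: I_def)
  qed
  \<comment> \<open>The divisor is \<open>I + 1\<close> because \<open>I\<close> may vanish.\<close>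
  then have *: "norm (LINT z|arc_measure. f z * of_real (g z)) / (I + 1) \<le> e" if "e > 0" for e
    using I that by (simp add: divide_le_eq distrib_left) (smt (verit, best))
  then have "norm (LINT z|arc_measure. f z * of_real (g z)) / (I + 1) \<le> 0"
    by (meson dense_ge)
  then show ?thesis using I by (simp add: divide_le_0_iff)
qed

text \<open>The integral of \<open>f\<close> vanishes over closed sets, whose indicators are limits
  of continuous functions, hence over all Borel sets by the pi-lambda argument, and this forces
  \<open>f\<close> to be null.\<close>

lemma zero_coeffs_AE_zero:
  assumes f: "zero_coeffs f"
  shows "AE z in arc_measure. f z = 0"
proof (rule arc.density_zero)
  show int: "integrable arc_measure f" using f by (simp add: zero_coeffs_def)
  have [measurable]: "f \<in> borel_measurable borel" using borel_measurable_integrable[OF int] by simp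
  have intA: "integrable arc_measure (\<lambda>z. indicator A z *\<^sub>R f z)" if "A \<in> sets borel" for A
    using integrable_mult_indicator[OF _ int, of A] that by simp
  have f0: "(LINT z|arc_measure. f z) = 0" using f by (auto simp: zero_coeffs_def dest: spec[of _ 0])
  fix A assume "A \<in> sets arc_measure"
  then have "Int_stable (Collect closed :: complex set set)" "Collect closed \<subseteq> Pow (UNIV :: complex set)"
    "A \<in> sigma_sets UNIV (Collect closed)" by (auto simp: borel_eq_closed Int_stable_def)
  then have "(LINT z|arc_measure. indicator A z *\<^sub>R f z) = 0"
  proof (induction rule: sigma_sets_induct_disjoint)
    case (basic K)
    then have K: "closed K" by simp
    show ?case
    \<comment> \<open>\<open>infdist\<close> to the empty set is 0 by convention, so the
      approximation below would converge to 1 there instead of 0.\<close>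
    proof (cases "K = {}")
      case False
      define g where "g n z = max 0 (1 - real n * infdist z K)" for n z
      have gc: "continuous_on UNIV (g n)" for n unfolding g_def by (intro continuous_intros)
      have [measurable]: "g n \<in> borel_measurable borel" for n
        by (rule borel_measurable_continuous_onI[OF gc])
      have [measurable]: "K \<in> sets borel" using K by simp
      have lim: "(\<lambda>n. g n z) \<longlonglongrightarrow> indicator K z" for z
      proof (cases "z \<in> K")
        case True then show ?thesis by (simp add: g_def)
      next
        case z: False
        then have d: "infdist z K > 0" using K False
          by (metis in_closed_iff_infdist_zero infdist_nonneg less_eq_real_def)
        obtain N where N: "1 \<le> real N * infdist z K" using d
          by (metis less_imp_le reals_Archimedean3)
        have "g n z = 0" if "n \<ge> N" for n
        proof -
          have "real N * infdist z K \<le> real n * infdist z K" using that d by (intro mult_right_mono) auto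
          then show ?thesis using N by (simp add: g_def)
        qed
        then have "eventually (\<lambda>n. g n z = 0) sequentially" by (auto simp: eventually_sequentially)
        then show ?thesis using z by (auto intro: tendsto_eventually)
      qed
      have "(\<lambda>n. LINT z|arc_measure. f z * of_real (g n z)) \<longlonglongrightarrow> (LINT z|arc_measure. indicator K z *\<^sub>R f z)"
      proof (rule integral_dominated_convergence[where w="\<lambda>z. norm (f z)"])
        have "(\<lambda>n. f z * of_real (g n z)) \<longlonglongrightarrow> f z * of_real (indicator K z)" for z
          by (intro tendsto_intros lim)
        then show "AE z in arc_measure. (\<lambda>n. f z * of_real (g n z)) \<longlonglongrightarrow> indicator K z *\<^sub>R f z"
          by (simp add: scaleR_conv_of_real mult.commute)
        show "AE z in arc_measure. norm (f z * of_real (g n z)) \<le> norm (f z)" for n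
        proof (rule AE_I2)
          fix z
          have "0 \<le> g n z" "g n z \<le> 1" by (auto simp: g_def infdist_nonneg)
          then show "norm (f z * of_real (g n z)) \<le> norm (f z)" by (simp add: norm_mult mult_left_le)
        qed
      qed (use int in auto)
      then show ?thesis using LIMSEQ_unique
        by (simp add: zero_coeffs_continuous[OF f gc] LIMSEQ_const_iff)
    qed simp
  next
    case (compl A)
    then have A: "A \<in> sets borel" by (simp add: borel_eq_closed)
    have "(LINT z|arc_measure. indicator (UNIV - A) z *\<^sub>R f z)
      = (LINT z|arc_measure. f z - indicator A z *\<^sub>R f z)"
      by (intro Bochner_Integration.integral_cong) (auto simp: indicator_def)
    also have "\<dots> = 0" using int intA[OF A] compl f0 by simp
    finally show ?case .
  next
    case (union A)
    then have A: "A i \<in> sets arc_measure" for i by (auto simp: borel_eq_closed)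
    have "set_lebesgue_integral arc_measure (\<Union>i. A i) f = (\<Sum>i. set_lebesgue_integral arc_measure (A i) f)"
    proof (rule lebesgue_integral_countable_add)
      show "set_integrable arc_measure (\<Union>i. A i) f"
        unfolding set_integrable_def by (rule intA) (use A in auto)
    qed (use A union(1) in \<open>auto simp: disjoint_family_on_def\<close>)
    then show ?case using union by (simp add: set_lebesgue_integral_def)
  qed simp
  then show "set_lebesgue_integral arc_measure A f = 0" by (simp add: set_lebesgue_integral_def)
qed

section \<open>The space of square integrable functions\<close>

text \<open>The squared \<open>L2\<close> norm. Squares keep the estimates free of roots; the
  triangle inequality then appears with a factor 2, which is harmless for density arguments.\<close>

definition Lsq :: "(complex \<Rightarrow> 'a::euclidean_space) \<Rightarrow> real" where
  "Lsq f = (LINT z|arc_measure. (norm (f z))\<^sup>2)"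

lemma Lsq_nonneg: "0 \<le> Lsq f"
  by (simp add: Lsq_def)

lemma L2_measurable: "f \<in> L2 \<Longrightarrow> f \<in> borel_measurable borel"
  by (simp add: L2_def)

lemma L2_integrable_square: "f \<in> L2 \<Longrightarrow> integrable arc_measure (\<lambda>z. (norm (f z))\<^sup>2)"
  by (simp add: L2_def)

lemma L2_bound:
  fixes f :: "complex \<Rightarrow> 'a::euclidean_space"
  assumes [measurable]: "f \<in> borel_measurable borel"
    and "integrable arc_measure w" and "AE z in arc_measure. (norm (f z))\<^sup>2 \<le> w z"
  shows "f \<in> L2"
proof -
  have "integrable arc_measure (\<lambda>z. (norm (f z))\<^sup>2)"
  proof (rule Bochner_Integration.integrable_bound[OF assms(2)])
    show "AE z in arc_measure. norm ((norm (f z))\<^sup>2) \<le> norm (w z)"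
      using assms(3) by eventually_elim auto
  qed simp
  then show ?thesis by (simp add: L2_def)
qed

lemma L2_cong_AE:
  fixes f :: "complex \<Rightarrow> 'a::euclidean_space"
  assumes "f \<in> borel_measurable borel" "g \<in> L2" "AE z in arc_measure. f z = g z"
  shows "f \<in> L2"
  by (rule L2_bound[OF assms(1) L2_integrable_square[OF assms(2)]])
    (use assms(3) in \<open>auto elim!: eventually_mono\<close>)

lemma Lsq_cong_AE:
  fixes f :: "complex \<Rightarrow> 'a::euclidean_space"
  assumes [measurable]: "f \<in> borel_measurable borel" "g \<in> borel_measurable borel"
    and "AE z in arc_measure. f z = g z"
  shows "Lsq f = Lsq g"
  unfolding Lsq_def by (rule integral_cong_AE) (use assms(3) in \<open>auto elim!: eventually_mono\<close>)

lemma parallelogram_law: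
  fixes x y :: "'a::real_inner"
  shows "(norm (x + y))\<^sup>2 + (norm (x - y))\<^sup>2 = 2 * (norm x)\<^sup>2 + 2 * (norm y)\<^sup>2"
  by (simp add: power2_norm_eq_inner inner_simps inner_commute)

lemma norm_add_square_le:
  fixes x y :: "'a::real_inner"
  shows "(norm (x + y))\<^sup>2 \<le> 2 * (norm x)\<^sup>2 + 2 * (norm y)\<^sup>2"
  using parallelogram_law[of x y] zero_le_power2[of "norm (x - y)"] by linarith

lemma L2_add:
  fixes f g :: "complex \<Rightarrow> 'a::euclidean_space"
  assumes f: "f \<in> L2" and g: "g \<in> L2"
  shows "(\<lambda>z. f z + g z) \<in> L2"
proof (rule L2_bound[where w = "\<lambda>z. 2 * (norm (f z))\<^sup>2 + 2 * (norm (g z))\<^sup>2"])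
  note [measurable] = L2_measurable[OF f] L2_measurable[OF g]
  show "(\<lambda>z. f z + g z) \<in> borel_measurable borel" by measurable
qed (simp_all add: L2_integrable_square f g norm_add_square_le)

lemma L2_bounded_linear:
  fixes f :: "complex \<Rightarrow> 'a::euclidean_space" and T :: "'a \<Rightarrow> 'b::euclidean_space"
  assumes T: "bounded_linear T" and f: "f \<in> L2"
  shows "(\<lambda>z. T (f z)) \<in> L2"
proof -
  obtain K where K: "\<And>x. norm (T x) \<le> norm x * K" "K > 0"
    using bounded_linear.pos_bounded[OF T] by blast
  note [measurable] = L2_measurable[OF f]
  show ?thesis
  proof (rule L2_bound[where w = "\<lambda>z. K\<^sup>2 * (norm (f z))\<^sup>2"])
    have [measurable]: "T \<in> borel_measurable borel"
      by (intro borel_measurable_continuous_onI linear_continuous_on T)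
    show "(\<lambda>z. T (f z)) \<in> borel_measurable borel" by measurable
    have "(norm (T (f z)))\<^sup>2 \<le> K\<^sup>2 * (norm (f z))\<^sup>2" for z
      using power_mono[OF K(1)[of "f z"], of 2] by (simp add: power_mult_distrib mult.commute)
    then show "AE z in arc_measure. (norm (T (f z)))\<^sup>2 \<le> K\<^sup>2 * (norm (f z))\<^sup>2" by simp
  qed (simp add: L2_integrable_square f)
qed

lemma L2_zero [simp]: "(\<lambda>z. 0) \<in> L2"
  by (simp add: L2_def)

lemma L2_diff:
  fixes f g :: "complex \<Rightarrow> 'a::euclidean_space"
  assumes f: "f \<in> L2" and g: "g \<in> L2"
  shows "(\<lambda>z. f z - g z) \<in> L2"
  using L2_add[OF f L2_bounded_linear[OF bounded_linear_minus[OF bounded_linear_ident] g]] by simp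

lemma L2_cmult: "f \<in> L2 \<Longrightarrow> (\<lambda>z. c * f z) \<in> L2" for c :: complex
  by (rule L2_bounded_linear[OF bounded_linear_mult_right])

lemma L2_sum:
  fixes f :: "'i \<Rightarrow> complex \<Rightarrow> 'a::euclidean_space"
  shows "(\<And>i. i \<in> I \<Longrightarrow> f i \<in> L2) \<Longrightarrow> (\<lambda>z. \<Sum>i\<in>I. f i z) \<in> L2"
  by (induction I rule: infinite_finite_induct) (auto intro: L2_add)

lemma L2_integrable:
  fixes f :: "complex \<Rightarrow> 'a::euclidean_space"
  assumes f: "f \<in> L2"
  shows "integrable arc_measure f"
proof (rule Bochner_Integration.integrable_bound)
  show "integrable arc_measure (\<lambda>z. 1 + (norm (f z))\<^sup>2)"
    using L2_integrable_square[OF f] by simp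
  show "f \<in> borel_measurable arc_measure" using L2_measurable[OF f] by simp
  have "norm (f z) \<le> 1 + (norm (f z))\<^sup>2" for z
    using zero_le_power2[of "norm (f z) - 1"] by (simp add: power2_diff) (use norm_ge_zero[of "f z"] in linarith)
  then show "AE z in arc_measure. norm (f z) \<le> norm (1 + (norm (f z))\<^sup>2)" by simp
qed

lemma L2_mult_integrable:
  fixes f g :: "complex \<Rightarrow> complex"
  assumes f: "f \<in> L2" and g: "g \<in> L2"
  shows "integrable arc_measure (\<lambda>z. f z * g z)"
proof (rule Bochner_Integration.integrable_bound)
  note [measurable] = L2_measurable[OF f] L2_measurable[OF g]
  show "integrable arc_measure (\<lambda>z. (norm (f z))\<^sup>2 + (norm (g z))\<^sup>2)"
    using f g by (simp add: L2_integrable_square)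
  show "(\<lambda>z. f z * g z) \<in> borel_measurable arc_measure" by measurable
  have "norm (f z) * norm (g z) \<le> (norm (f z))\<^sup>2 + (norm (g z))\<^sup>2" for z
    using sum_squares_bound[of "norm (f z)" "norm (g z)"] mult_nonneg_nonneg[OF norm_ge_zero norm_ge_zero, of "f z" "g z"]
    by linarith
  then show "AE z in arc_measure. norm (f z * g z) \<le> norm ((norm (f z))\<^sup>2 + (norm (g z))\<^sup>2)"
    by (simp add: norm_mult)
qed

lemma L2_cnj: "f \<in> L2 \<Longrightarrow> (\<lambda>z. cnj (f z)) \<in> L2"
  by (rule L2_bounded_linear[OF bounded_linear_cnj])

text \<open>Nonnegativity of the variance of \<open>norm (f z)\<close>, the measure being a
  probability measure.\<close>

lemma integral_norm_square_le:
  fixes f :: "complex \<Rightarrow> 'a::euclidean_space"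
  assumes f: "f \<in> L2"
  shows "(LINT z|arc_measure. norm (f z))\<^sup>2 \<le> Lsq f"
proof -
  define m where "m = (LINT z|arc_measure. norm (f z))"
  have [simp]: "integrable arc_measure (\<lambda>z. norm (f z))" "integrable arc_measure (\<lambda>z. (norm (f z))\<^sup>2)"
    using L2_integrable[OF f] L2_integrable_square[OF f] by auto
  have "0 \<le> (LINT z|arc_measure. (norm (f z) - m)\<^sup>2)" by simp
  also have "(\<lambda>z. (norm (f z) - m)\<^sup>2) = (\<lambda>z. (norm (f z))\<^sup>2 + m\<^sup>2 - 2 * m * norm (f z))"
    by (simp add: power2_diff mult_ac)
  also have "(LINT z|arc_measure. (norm (f z))\<^sup>2 + m\<^sup>2 - 2 * m * norm (f z)) = Lsq f + m\<^sup>2 - 2 * m * m"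
    by (simp add: Lsq_def m_def[symmetric])
  also have "\<dots> = Lsq f - m\<^sup>2" by (simp add: power2_eq_square)
  finally show ?thesis by (simp add: m_def)
qed

lemma Lsq_triangle:
  fixes f g h :: "complex \<Rightarrow> 'a::euclidean_space"
  assumes f: "f \<in> L2" and g: "g \<in> L2" and h: "h \<in> L2"
  shows "Lsq (\<lambda>z. f z - g z) \<le> 2 * Lsq (\<lambda>z. f z - h z) + 2 * Lsq (\<lambda>z. h z - g z)"
proof -
  have i: "integrable arc_measure (\<lambda>z. (norm (f z - h z))\<^sup>2)"
    "integrable arc_measure (\<lambda>z. (norm (h z - g z))\<^sup>2)"
    "integrable arc_measure (\<lambda>z. (norm (f z - g z))\<^sup>2)"
    using f g h by (auto intro: L2_integrable_square L2_diff)
  have "Lsq (\<lambda>z. f z - g z) \<le> (LINT z|arc_measure. 2 * (norm (f z - h z))\<^sup>2 + 2 * (norm (h z - g z))\<^sup>2)"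
    unfolding Lsq_def using i norm_add_square_le[of "f z - h z" "h z - g z" for z]
    by (intro integral_mono) auto
  then show ?thesis using i by (simp add: Lsq_def)
qed

lemma L2_dist_less_iff: "e > 0 \<Longrightarrow> L2_dist f g < e \<longleftrightarrow> Lsq (\<lambda>z. f z - g z) < e\<^sup>2"
  unfolding L2_dist_def Lsq_def
  using real_sqrt_less_iff[of "LINT z|arc_measure. (norm (f z - g z))\<^sup>2" "e\<^sup>2"] by simp

lemma closed_span_iff:
  "f \<in> closed_span sc S \<longleftrightarrow> f \<in> L2 \<and> (\<forall>e>0. \<exists>g\<in>lin_span sc S. Lsq (\<lambda>z. f z - g z) < e)"
proof -
  have "(\<forall>e>0. \<exists>g\<in>lin_span sc S. L2_dist f g < e)
    \<longleftrightarrow> (\<forall>e>0. \<exists>g\<in>lin_span sc S. Lsq (\<lambda>z. f z - g z) < e)"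
  proof safe
    fix e :: real assume "e > 0"
    moreover assume "\<forall>e>0. \<exists>g\<in>lin_span sc S. L2_dist f g < e"
    ultimately obtain g where "g \<in> lin_span sc S" "L2_dist f g < sqrt e" by (meson real_sqrt_gt_zero)
    then show "\<exists>g\<in>lin_span sc S. Lsq (\<lambda>z. f z - g z) < e"
      using \<open>e > 0\<close> L2_dist_less_iff[of "sqrt e" f g] by auto
  next
    fix e :: real assume "e > 0"
    moreover assume "\<forall>e>0. \<exists>g\<in>lin_span sc S. Lsq (\<lambda>z. f z - g z) < e"
    ultimately show "\<exists>g\<in>lin_span sc S. L2_dist f g < e"
      using L2_dist_less_iff[of e f] by (metis zero_less_power)
  qed
  then show ?thesis by (simp add: closed_span_def)
qed

lemma lin_span_L2:
  assumes "\<And>c. bounded_linear (sc c)" "S \<subseteq> L2"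
  shows "lin_span sc S \<subseteq> L2"
proof
  fix f assume "f \<in> lin_span sc S"
  then obtain T c where f: "f = (\<lambda>z. \<Sum>g\<in>T. sc (c g) (g z))" and T: "T \<subseteq> S"
    by (auto simp: lin_span_def)
  show "f \<in> L2"
    unfolding f by (intro L2_sum L2_bounded_linear[OF assms(1)]) (use T assms(2) in auto)
qed

lemma closed_span_L2: "closed_span sc S \<subseteq> L2"
  by (auto simp: closed_span_def)

lemma lin_span_superset:
  assumes "\<And>v. sc 1 v = v"
  shows "S \<subseteq> lin_span sc S"
proof
  fix g assume "g \<in> S"
  then show "g \<in> lin_span sc S"
    unfolding lin_span_def by (intro CollectI exI[of _ "{g}"] exI[of _ "\<lambda>_. 1"]) (auto simp: assms)
qed

lemma lin_span_closed_span:
  assumes "\<And>c. bounded_linear (sc c)" "S \<subseteq> L2"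
  shows "lin_span sc S \<subseteq> closed_span sc S"
proof
  fix g assume g: "g \<in> lin_span sc S"
  moreover have "Lsq (\<lambda>z. g z - g z) = 0" by (simp add: Lsq_def)
  ultimately show "g \<in> closed_span sc S"
    using lin_span_L2[of sc, OF assms] by (auto simp: closed_span_iff intro!: bexI[of _ g])
qed

text \<open>Integrating \<open>a z (f z)\<close> is a functional of \<open>f\<close> that is
  continuous in the \<open>L2\<close> norm, so its kernel is closed. The value space and
  \<open>sc\<close> stay general so that the same argument reads off Fourier coefficients of scalar
  and of vector functions.\<close>

lemma closed_span_functional:
  fixes a :: "complex \<Rightarrow> 'a::euclidean_space \<Rightarrow> complex"
  assumes sc: "\<And>c. bounded_linear (sc c)" and S: "S \<subseteq> L2"
    and meas: "\<And>f. f \<in> borel_measurable borel \<Longrightarrow> (\<lambda>z. a z (f z)) \<in> borel_measurable borel"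
    and lin: "\<And>z. linear (a z)" and hom: "\<And>z c v. a z (sc c v) = c * a z v"
    and bd: "AE z in arc_measure. \<forall>v. norm (a z v) \<le> C * norm v"
    and zero: "\<And>g. g \<in> S \<Longrightarrow> (LINT z|arc_measure. a z (g z)) = 0"
    and f: "f \<in> closed_span sc S"
  shows "(LINT z|arc_measure. a z (f z)) = 0"
proof -
  have int: "integrable arc_measure (\<lambda>z. a z (g z))"
    and norm: "norm (LINT z|arc_measure. a z (g z)) \<le> \<bar>C\<bar> * sqrt (Lsq g)" if g: "g \<in> L2" for g
  proof -
    have bd': "AE z in arc_measure. norm (a z (g z)) \<le> \<bar>C\<bar> * norm (g z)"
      using bd by eventually_elim (smt (verit) mult_right_mono norm_ge_zero)
    have ig: "integrable arc_measure (\<lambda>z. \<bar>C\<bar> * norm (g z))" using L2_integrable[OF g] by simp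
    have [measurable]: "(\<lambda>z. a z (g z)) \<in> borel_measurable borel" by (rule meas[OF L2_measurable[OF g]])
    show int: "integrable arc_measure (\<lambda>z. a z (g z))"
      by (rule Bochner_Integration.integrable_bound[OF ig])
        (use bd' in \<open>auto simp: abs_mult elim!: eventually_mono\<close>)
    have "norm (LINT z|arc_measure. a z (g z)) \<le> (LINT z|arc_measure. norm (a z (g z)))"
      by (rule integral_norm_bound)
    also have "\<dots> \<le> (LINT z|arc_measure. \<bar>C\<bar> * norm (g z))"
      by (rule integral_mono_AE) (use int ig bd' in auto)
    also have "\<dots> = \<bar>C\<bar> * (LINT z|arc_measure. norm (g z))" by simp
    also have "\<dots> \<le> \<bar>C\<bar> * sqrt (Lsq g)"
      using integral_norm_square_le[OF g] by (intro mult_left_mono real_le_rsqrt) auto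
    finally show "norm (LINT z|arc_measure. a z (g z)) \<le> \<bar>C\<bar> * sqrt (Lsq g)" .
  qed
  have span0: "(LINT z|arc_measure. a z (g z)) = 0" if gS: "g \<in> lin_span sc S" for g
  proof -
    obtain T c where g: "g = (\<lambda>z. \<Sum>h\<in>T. sc (c h) (h z))" and T: "finite T" "T \<subseteq> S"
      using gS by (auto simp: lin_span_def)
    have "(LINT z|arc_measure. a z (g z)) = (LINT z|arc_measure. (\<Sum>h\<in>T. c h * a z (h z)))"
      by (simp add: g linear_sum[OF lin] hom)
    also have "\<dots> = (\<Sum>h\<in>T. LINT z|arc_measure. c h * a z (h z))"
      using T S by (intro Bochner_Integration.integral_sum integrable_mult_right int) auto
    also have "\<dots> = 0" using T zero by (intro sum.neutral) auto
    finally show ?thesis .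
  qed
  have fL: "f \<in> L2" using f by (simp add: closed_span_iff)
  have le: "norm (LINT z|arc_measure. a z (f z)) \<le> \<bar>C\<bar> * e" if e: "e > 0" for e
  proof -
    obtain g where g: "g \<in> lin_span sc S" "Lsq (\<lambda>z. f z - g z) < e\<^sup>2"
      using f e unfolding closed_span_iff by (meson zero_less_power)
    have gL: "g \<in> L2" using g(1) lin_span_L2[of sc, OF sc S] by auto
    have "(LINT z|arc_measure. a z (f z)) = (LINT z|arc_measure. a z (f z - g z))"
      using int[OF fL] int[OF gL] span0[OF g(1)] by (simp add: linear_diff[OF lin])
    also have "norm \<dots> \<le> \<bar>C\<bar> * sqrt (Lsq (\<lambda>z. f z - g z))" by (rule norm[OF L2_diff[OF fL gL]])
    also have "\<dots> \<le> \<bar>C\<bar> * e" using g(2) e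
      by (intro mult_left_mono) (auto intro: real_le_lsqrt simp: Lsq_nonneg)
    finally show ?thesis .
  qed
  have *: "norm (LINT z|arc_measure. a z (f z)) \<le> 0 + e" if "e > 0" for e
  proof -
    have "norm (LINT z|arc_measure. a z (f z)) \<le> \<bar>C\<bar> * (e / (\<bar>C\<bar> + 1))" using that by (intro le) auto
    also have "\<dots> \<le> e" using that by (simp add: divide_le_eq)
    finally show ?thesis by simp
  qed
  have "norm (LINT z|arc_measure. a z (f z)) \<le> 0" by (rule field_le_epsilon) (rule *)
  then show ?thesis by simp
qed

subsection \<open>Completeness and orthogonal projections\<close>

text \<open>Fatou's lemma: an almost everywhere limit inherits norm bounds. This turns pointwise
  limits into \<open>L2\<close> limits below.\<close>

lemma Lsq_Fatou:
  fixes u :: "nat \<Rightarrow> complex \<Rightarrow> complex"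
  assumes u: "\<And>k. u k \<in> L2" and f [measurable]: "f \<in> borel_measurable borel"
    and lim: "AE z in arc_measure. (\<lambda>k. u k z) \<longlonglongrightarrow> f z"
    and B: "\<forall>\<^sub>F k in sequentially. Lsq (u k) \<le> B"
  shows "f \<in> L2" "Lsq f \<le> B"
proof -
  note [measurable] = L2_measurable[OF u]
  have B0: "B \<ge> 0" using B Lsq_nonneg order_trans by (metis (mono_tags) eventually_sequentially order_refl)
  have nn: "(\<integral>\<^sup>+z. ennreal ((norm (u k z))\<^sup>2) \<partial>arc_measure) = ennreal (Lsq (u k))" for k
    unfolding Lsq_def by (rule nn_integral_eq_integral) (auto intro: L2_integrable_square u)
  have "(\<integral>\<^sup>+z. ennreal ((norm (f z))\<^sup>2) \<partial>arc_measure)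
    = (\<integral>\<^sup>+z. liminf (\<lambda>k. ennreal ((norm (u k z))\<^sup>2)) \<partial>arc_measure)"
  proof (rule nn_integral_cong_AE, use lim in eventually_elim)
    case (elim z)
    then have "(\<lambda>k. ennreal ((norm (u k z))\<^sup>2)) \<longlonglongrightarrow> ennreal ((norm (f z))\<^sup>2)"
      by (intro tendsto_intros)
    then show ?case using lim_imp_Liminf by (metis sequentially_bot)
  qed
  also have "\<dots> \<le> liminf (\<lambda>k. \<integral>\<^sup>+z. ennreal ((norm (u k z))\<^sup>2) \<partial>arc_measure)"
    by (rule nn_integral_liminf) auto
  also have "\<dots> \<le> liminf (\<lambda>k. ennreal B)"
    unfolding nn by (rule Liminf_mono) (use B in \<open>auto elim!: eventually_mono intro: ennreal_leI\<close>)
  also have "\<dots> = ennreal B" by (simp add: Liminf_const)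
  finally have le: "(\<integral>\<^sup>+z. ennreal ((norm (f z))\<^sup>2) \<partial>arc_measure) \<le> ennreal B" .
  then have int: "integrable arc_measure (\<lambda>z. (norm (f z))\<^sup>2)"
    by (intro integrableI_bounded) (auto simp: le_less_trans[OF _ ennreal_less_top])
  then show "f \<in> L2" by (simp add: L2_def)
  show "Lsq f \<le> B"
    using le nn_integral_eq_integral[OF int] B0 by (simp add: Lsq_def)
qed

text \<open>The L1 norms of the increments are at most \<open>(1/2) ^ k\<close>, so their sum is
  integrable and the telescoping series converges absolutely almost everywhere.\<close>

lemma L2_fast_Cauchy_AE_convergent:
  fixes u :: "nat \<Rightarrow> complex \<Rightarrow> complex"
  assumes u: "\<And>k. u k \<in> L2" and fast: "\<And>k. Lsq (\<lambda>z. u (Suc k) z - u k z) \<le> (1/4) ^ k"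
  shows "\<exists>f\<in>borel_measurable borel. AE z in arc_measure. (\<lambda>k. u k z) \<longlonglongrightarrow> f z"
proof (intro bexI)
  note [measurable] = L2_measurable[OF u]
  define d where "d k z = norm (u (Suc k) z - u k z)" for k z
  have [measurable]: "d k \<in> borel_measurable borel" for k unfolding d_def by measurable
  show "(\<lambda>z. lim (\<lambda>k. u k z)) \<in> borel_measurable borel" by measurable
  have "(\<integral>\<^sup>+z. ennreal (d k z) \<partial>arc_measure) \<le> ennreal ((1/2) ^ k)" for k
  proof -
    have L: "(\<lambda>z. u (Suc k) z - u k z) \<in> L2" by (intro L2_diff u)
    have "(LINT z|arc_measure. d k z)\<^sup>2 \<le> (1/4) ^ k"
      using integral_norm_square_le[OF L] fast[of k] by (simp add: d_def)
    also have "\<dots> = ((1/2) ^ k)\<^sup>2" by (simp add: power2_eq_square power_mult_distrib[symmetric])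
    finally have "(LINT z|arc_measure. d k z) \<le> (1/2) ^ k" by (rule power2_le_imp_le) simp
    then show ?thesis using L2_integrable[OF L]
      by (subst nn_integral_eq_integral) (auto simp: d_def[abs_def] intro!: ennreal_leI)
  qed
  then have "(\<integral>\<^sup>+z. (\<Sum>k. ennreal (d k z)) \<partial>arc_measure) \<le> (\<Sum>k. ennreal ((1/2) ^ k))"
    by (subst nn_integral_suminf) (auto intro!: suminf_le)
  also have "\<dots> = ennreal (\<Sum>k. (1/2) ^ k)" by (rule suminf_ennreal2) (auto intro: summable_geometric)
  also have "\<dots> < \<infinity>" by simp
  finally have "(\<integral>\<^sup>+z. (\<Sum>k. ennreal (d k z)) \<partial>arc_measure) \<noteq> \<infinity>" by simp
  then have "AE z in arc_measure. (\<Sum>k. ennreal (d k z)) \<noteq> \<infinity>"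
    by (intro nn_integral_PInf_AE) auto
  then show "AE z in arc_measure. (\<lambda>k. u k z) \<longlonglongrightarrow> lim (\<lambda>k. u k z)"
  proof eventually_elim
    case (elim z)
    then have "summable (\<lambda>k. d k z)"
      by (intro summable_suminf_not_top) (auto simp: d_def)
    then have "summable (\<lambda>k. u (Suc k) z - u k z)"
      unfolding d_def by (rule summable_norm_cancel)
    then have "convergent (\<lambda>n. (\<Sum>k<n. u (Suc k) z - u k z) + u 0 z)"
      by (intro convergent_add convergent_const) (simp add: summable_iff_convergent)
    then have "convergent (\<lambda>k. u k z)" using sum_lessThan_telescope[of "\<lambda>k. u k z"] by simp
    then show ?case by (simp add: convergent_LIMSEQ_iff)
  qed
qed

text \<open>The classical projection theorem: near-minimisers of the distance to \<open>f\<close>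
  form a Cauchy sequence by the parallelogram law, and the residual of the minimiser is orthogonal
  by a first-order perturbation.\<close>

lemma L2_projection:
  fixes M :: "(complex \<Rightarrow> complex) set"
  assumes MsubL: "M \<subseteq> L2" and M0: "(\<lambda>z. 0) \<in> M"
    and add: "\<And>f g. f \<in> M \<Longrightarrow> g \<in> M \<Longrightarrow> (\<lambda>z. f z + g z) \<in> M"
    and cmult: "\<And>f c. f \<in> M \<Longrightarrow> (\<lambda>z. c * f z) \<in> M"
    and closed: "\<And>f. f \<in> L2 \<Longrightarrow> (\<And>e. e > 0 \<Longrightarrow> \<exists>g\<in>M. Lsq (\<lambda>z. f z - g z) < e) \<Longrightarrow> f \<in> M"
    and f: "f \<in> L2"
  shows "\<exists>p\<in>M. \<forall>m\<in>M. (LINT z|arc_measure. (f z - p z) * cnj (m z)) = 0"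
proof -
  have L: "m \<in> L2" if "m \<in> M" for m using that MsubL by auto
  define d where "d = (INF m\<in>M. Lsq (\<lambda>z. f z - m z))"
  have bdd: "bdd_below ((\<lambda>m. Lsq (\<lambda>z. f z - m z)) ` M)" by (auto simp: Lsq_nonneg intro!: bdd_belowI[of _ 0])
  have d_le: "d \<le> Lsq (\<lambda>z. f z - m z)" if "m \<in> M" for m
    unfolding d_def by (rule cINF_lower[OF bdd that])
  \<comment> \<open>Chosen so that \<open>2 * (\<epsilon> (Suc k) + \<epsilon> k)\<close>, which is
    5/8 of \<open>(1/4) ^ k\<close>, stays below the rate required for almost everywhere
    convergence.\<close>
  define \<epsilon> :: "nat \<Rightarrow> real" where "\<epsilon> n = (1/4) ^ Suc n" for n
  have "\<exists>m. m \<in> M \<and> Lsq (\<lambda>z. f z - m z) < d + \<epsilon> n" for n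
    using cInf_lessD[of "(\<lambda>m. Lsq (\<lambda>z. f z - m z)) ` M" "d + \<epsilon> n"] M0 by (auto simp: d_def \<epsilon>_def)
  then obtain u where uM: "\<And>n. u n \<in> M" and u_less: "\<And>n. Lsq (\<lambda>z. f z - u n z) < d + \<epsilon> n"
    by metis
  have cauchy: "Lsq (\<lambda>z. u i z - u j z) \<le> 2 * (\<epsilon> i + \<epsilon> j)" for i j
  proof -
    \<comment> \<open>The midpoint lies in \<open>M\<close>, so its squared distance to
      \<open>f\<close> is at least \<open>d\<close>; this is the lower bound that the parallelogram
      law needs.\<close>
    define m where "m z = (1/2) * (u i z + u j z)" for z
    have m: "m \<in> M" unfolding m_def by (intro cmult add uM)
    have i: "integrable arc_measure (\<lambda>z. (norm (f z - u i z))\<^sup>2)"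
      "integrable arc_measure (\<lambda>z. (norm (f z - u j z))\<^sup>2)"
      "integrable arc_measure (\<lambda>z. (norm (f z - m z))\<^sup>2)"
      by (simp_all add: L2_integrable_square L2_diff L f uM m)
    have pl: "(norm (u i z - u j z))\<^sup>2
      = 2 * (norm (f z - u i z))\<^sup>2 + 2 * (norm (f z - u j z))\<^sup>2 - 4 * (norm (f z - m z))\<^sup>2" for z
    proof -
      have "norm (f z - u i z + (f z - u j z)) = norm (2 * (f z - m z))"
        by (rule arg_cong[where f = norm]) (simp add: m_def field_simps)
      then have "(norm (f z - u i z + (f z - u j z)))\<^sup>2 = 4 * (norm (f z - m z))\<^sup>2"
        by (simp only: norm_mult power_mult_distrib) simp
      moreover have "norm (f z - u i z - (f z - u j z)) = norm (u i z - u j z)"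
        by (simp add: norm_minus_commute)
      ultimately show ?thesis using parallelogram_law[of "f z - u i z" "f z - u j z"] by simp
    qed
    have "Lsq (\<lambda>z. u i z - u j z)
      = 2 * Lsq (\<lambda>z. f z - u i z) + 2 * Lsq (\<lambda>z. f z - u j z) - 4 * Lsq (\<lambda>z. f z - m z)"
      unfolding Lsq_def pl using i by simp
    then show ?thesis using d_le[OF m] u_less[of i] u_less[of j] by simp
  qed
  have uL: "u n \<in> L2" for n by (rule L[OF uM])
  have fast: "Lsq (\<lambda>z. u (Suc k) z - u k z) \<le> (1/4) ^ k" for k
  proof -
    have "(0::real) \<le> (1/4) ^ k" by simp
    moreover have "Lsq (\<lambda>z. u (Suc k) z - u k z) * 8 \<le> 5 * (1/4) ^ k"
      using cauchy[of "Suc k" k] by (simp add: \<epsilon>_def)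
    ultimately show ?thesis by linarith
  qed
  obtain p where p [measurable]: "p \<in> borel_measurable borel"
    and lim: "AE z in arc_measure. (\<lambda>k. u k z) \<longlonglongrightarrow> p z"
    using L2_fast_Cauchy_AE_convergent[of u, OF uL fast] by blast
  note [measurable] = L2_measurable[OF uL] L2_measurable[OF f]
  have eps: "\<epsilon> j \<le> \<epsilon> i" if "i \<le> j" for i j using that by (auto simp: \<epsilon>_def intro!: power_decreasing)
  have eps0: "\<epsilon> \<longlonglongrightarrow> 0" unfolding \<epsilon>_def by (intro LIMSEQ_Suc LIMSEQ_power_zero) simp
  \<comment> \<open>So far \<open>p\<close> is only a pointwise limit. Fatou with \<open>n\<close>
    fixed and \<open>k\<close> running makes it the \<open>L2\<close> limit, at an explicit
    rate.\<close>
  have pd: "(\<lambda>z. u n z - p z) \<in> L2" "Lsq (\<lambda>z. u n z - p z) \<le> 4 * \<epsilon> n" for n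
  proof -
    have ae: "AE z in arc_measure. (\<lambda>k. u n z - u k z) \<longlonglongrightarrow> u n z - p z"
      using lim by eventually_elim (rule tendsto_diff[OF tendsto_const])
    have ev: "\<forall>\<^sub>F k in sequentially. Lsq (\<lambda>z. u n z - u k z) \<le> 4 * \<epsilon> n"
      unfolding eventually_sequentially
    proof (intro exI[of _ n] allI impI)
      fix k assume "k \<ge> n"
      then show "Lsq (\<lambda>z. u n z - u k z) \<le> 4 * \<epsilon> n" using cauchy[of n k] eps[of n k] by simp
    qed
    show "(\<lambda>z. u n z - p z) \<in> L2" "Lsq (\<lambda>z. u n z - p z) \<le> 4 * \<epsilon> n"
      by (rule Lsq_Fatou[OF L2_diff[OF uL uL] _ ae ev]; measurable)+
  qed
  have pL: "p \<in> L2" using L2_diff[OF uL[of 0] pd(1)[of 0]] by simp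
  have pM: "p \<in> M"
  proof (rule closed[OF pL])
    fix e :: real assume "e > 0"
    then obtain n where "\<epsilon> n < e / 4"
      using eventually_happens'[OF sequentially_bot order_tendstoD(2)[OF eps0, of "e / 4"]] by auto
    then have "Lsq (\<lambda>z. u n z - p z) < e" using pd(2)[of n] by simp
    then show "\<exists>g\<in>M. Lsq (\<lambda>z. p z - g z) < e"
      using uM by (intro bexI[of _ "u n"]) (auto simp: Lsq_def norm_minus_commute)
  qed
  define r where "r z = f z - p z" for z
  have rL: "r \<in> L2" unfolding r_def by (intro L2_diff f pL)
  have r_min: "Lsq r \<le> d"
  proof (rule field_le_epsilon)
    fix e :: real assume e: "e > 0"
    have ae: "AE z in arc_measure. (\<lambda>k. f z - u k z) \<longlonglongrightarrow> r z"
      using lim unfolding r_def by eventually_elim (rule tendsto_diff[OF tendsto_const])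
    have ev: "\<forall>\<^sub>F k in sequentially. Lsq (\<lambda>z. f z - u k z) \<le> d + e"
      using order_tendstoD(2)[OF eps0 e]
    proof eventually_elim
      case (elim k) then show ?case using u_less[of k] by simp
    qed
    show "Lsq r \<le> d + e"
      by (rule Lsq_Fatou(2)[OF L2_diff[OF f uL] L2_measurable[OF rL] ae ev])
  qed
  have "(LINT z|arc_measure. r z * cnj (m z)) = 0" if m: "m \<in> M" for m
  proof -
    define a where "a = (LINT z|arc_measure. r z * cnj (m z))"
    \<comment> \<open>A step length that makes the quadratic term
      \<open>t\<^sup>2 * (norm a)\<^sup>2 * Lsq m\<close> at most
      \<open>t * (norm a)\<^sup>2\<close>, half of the linear gain; adding 1 covers
      \<open>Lsq m = 0\<close>.\<close>
    define t where "t = 1 / (Lsq m + 1)"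
    define c where "c = t *\<^sub>R a"
    have mL: "m \<in> L2" by (rule L[OF m])
    have i: "integrable arc_measure (\<lambda>z. (norm (r z))\<^sup>2)" "integrable arc_measure (\<lambda>z. (norm (m z))\<^sup>2)"
      "integrable arc_measure (\<lambda>z. r z * cnj (m z))"
      using L2_integrable_square[OF rL] L2_integrable_square[OF mL] L2_mult_integrable[OF rL L2_cnj[OF mL]]
      by auto
    have "(norm (r z - c * m z))\<^sup>2
      = (norm (r z))\<^sup>2 - 2 * Re (cnj c * (r z * cnj (m z))) + (norm c)\<^sup>2 * (norm (m z))\<^sup>2" for z
      unfolding cmod_power2 by (simp add: power2_eq_square algebra_simps)
    moreover have "(LINT z|arc_measure. Re (cnj c * (r z * cnj (m z)))) = Re (cnj c * a)"
    proof -
      have "(LINT z|arc_measure. Re (cnj c * (r z * cnj (m z)))) = Re (LINT z|arc_measure. cnj c * (r z * cnj (m z)))"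
        by (rule integral_Re) (intro integrable_mult_right i)
      then show ?thesis by (simp add: a_def)
    qed
    moreover have "integrable arc_measure (\<lambda>z. Re (cnj c * (r z * cnj (m z))))"
      by (intro integrable_Re integrable_mult_right i)
    ultimately have "Lsq (\<lambda>z. r z - c * m z) = Lsq r - 2 * Re (cnj c * a) + (norm c)\<^sup>2 * Lsq m"
      unfolding Lsq_def using i by (simp del: complex_cnj_mult times_complex.sel)
    moreover have "Lsq (\<lambda>z. r z - c * m z) \<ge> Lsq r"
      using r_min d_le[OF add[OF pM cmult[OF m, of c]]] by (simp add: r_def diff_diff_eq)
    ultimately have "2 * Re (cnj c * a) \<le> (norm c)\<^sup>2 * Lsq m" by linarith
    moreover have "Re (cnj c * a) = t * (norm a)\<^sup>2"
      unfolding c_def cmod_power2 by (simp add: power2_eq_square algebra_simps)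
    moreover have "(norm c)\<^sup>2 = t\<^sup>2 * (norm a)\<^sup>2" by (simp add: c_def power_mult_distrib)
    ultimately have "2 * (t * (norm a)\<^sup>2) \<le> t\<^sup>2 * (norm a)\<^sup>2 * Lsq m" by simp
    moreover have t: "t > 0" "t * Lsq m \<le> 1" using Lsq_nonneg[of m] by (auto simp: t_def)
    moreover have "t\<^sup>2 * (norm a)\<^sup>2 * Lsq m = t * (norm a)\<^sup>2 * (t * Lsq m)" by (simp add: power2_eq_square)
    moreover have "t * (norm a)\<^sup>2 * (t * Lsq m) \<le> t * (norm a)\<^sup>2 * 1" using t by (intro mult_left_mono) auto
    ultimately have "t * (norm a)\<^sup>2 \<le> 0" by linarith
    then show ?thesis using t by (simp add: a_def[symmetric] mult_le_0_iff)
  qed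
  then show ?thesis using pM by (auto simp: r_def)
qed

lemma Lsq_mult_le:
  fixes m f :: "complex \<Rightarrow> complex"
  assumes f: "f \<in> L2" and m: "m \<in> borel_measurable borel" "AE z in arc_measure. norm (m z) \<le> C"
  shows "(\<lambda>z. m z * f z) \<in> L2" "Lsq (\<lambda>z. m z * f z) \<le> C\<^sup>2 * Lsq f"
proof -
  note [measurable] = m(1) L2_measurable[OF f]
  have le: "AE z in arc_measure. (norm (m z * f z))\<^sup>2 \<le> C\<^sup>2 * (norm (f z))\<^sup>2"
    using m(2)
  proof eventually_elim
    case (elim z)
    then have "(norm (m z))\<^sup>2 * (norm (f z))\<^sup>2 \<le> C\<^sup>2 * (norm (f z))\<^sup>2"
      by (intro mult_right_mono power_mono) auto
    then show ?case by (simp add: norm_mult power_mult_distrib)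
  qed
  show L: "(\<lambda>z. m z * f z) \<in> L2"
    by (rule L2_bound[OF _ _ le]) (simp_all add: L2_integrable_square f)
  have "Lsq (\<lambda>z. m z * f z) \<le> (LINT z|arc_measure. C\<^sup>2 * (norm (f z))\<^sup>2)"
    unfolding Lsq_def by (rule integral_mono_AE[OF _ _ le]) (simp_all add: L2_integrable_square f L)
  then show "Lsq (\<lambda>z. m z * f z) \<le> C\<^sup>2 * Lsq f" by (simp add: Lsq_def)
qed

lemma Lsq_add_le:
  fixes f g :: "complex \<Rightarrow> complex"
  assumes "f \<in> L2" "g \<in> L2"
  shows "Lsq (\<lambda>z. f z + g z) \<le> 2 * Lsq f + 2 * Lsq g"
  using Lsq_triangle[OF assms(1) L2_cmult[OF assms(2), of "-1"] L2_zero] by (simp add: Lsq_def)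

subsection \<open>Closed spans of scalar functions\<close>

lemma lin_span_scalar_L2: "S \<subseteq> L2 \<Longrightarrow> lin_span (*) S \<subseteq> L2" for S :: "(complex \<Rightarrow> complex) set"
  by (rule lin_span_L2) (rule bounded_linear_mult_right)

lemma lin_span_add:
  fixes S :: "(complex \<Rightarrow> complex) set"
  assumes f: "f \<in> lin_span (*) S" and g: "g \<in> lin_span (*) S"
  shows "(\<lambda>z. f z + g z) \<in> lin_span (*) S"
proof -
  obtain T c where T: "finite T" "T \<subseteq> S" "f = (\<lambda>z. \<Sum>h\<in>T. c h * h z)"
    using f by (auto simp: lin_span_def)
  obtain T' c' where T': "finite T'" "T' \<subseteq> S" "g = (\<lambda>z. \<Sum>h\<in>T'. c' h * h z)"
    using g by (auto simp: lin_span_def)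
  \<comment> \<open>Both combinations are rewritten over the union of their generator sets, with
    coefficients extended by zero.\<close>
  define b where "b h = (if h \<in> T then c h else 0) + (if h \<in> T' then c' h else 0)" for h
  have "(\<Sum>h\<in>T. c h * h z) = (\<Sum>h\<in>T \<union> T'. (if h \<in> T then c h else 0) * h z)" for z
    using T T' by (intro sum.mono_neutral_cong_left) auto
  moreover have "(\<Sum>h\<in>T'. c' h * h z) = (\<Sum>h\<in>T \<union> T'. (if h \<in> T' then c' h else 0) * h z)" for z
    using T T' by (intro sum.mono_neutral_cong_left) auto
  ultimately have "(\<lambda>z. f z + g z) = (\<lambda>z. \<Sum>h\<in>T \<union> T'. b h * h z)"
    by (simp add: T(3) T'(3) b_def distrib_right sum.distrib)
  then show ?thesis
    using T T' unfolding lin_span_def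
    by (intro CollectI exI[of _ "T \<union> T'"] exI[of _ b]) auto
qed

lemma lin_span_cmult:
  fixes S :: "(complex \<Rightarrow> complex) set"
  assumes f: "f \<in> lin_span (*) S"
  shows "(\<lambda>z. c * f z) \<in> lin_span (*) S"
proof -
  obtain T b where T: "finite T" "T \<subseteq> S" "f = (\<lambda>z. \<Sum>h\<in>T. b h * h z)"
    using f by (auto simp: lin_span_def)
  then have "(\<lambda>z. c * f z) = (\<lambda>z. \<Sum>h\<in>T. (c * b h) * h z)"
    by (simp add: sum_distrib_left mult.assoc)
  then show ?thesis
    using T unfolding lin_span_def by (intro CollectI exI[of _ T] exI[of _ "\<lambda>h. c * b h"]) auto
qed

context
  fixes S :: "(complex \<Rightarrow> complex) set"
  assumes S: "S \<subseteq> L2"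
begin

lemma closed_span_superset: "S \<subseteq> closed_span (*) S"
  using lin_span_superset[of "(*)" S] lin_span_closed_span[of "(*)" S] S
  by (auto intro: bounded_linear_mult_right)

lemma closed_span_limit:
  assumes f: "f \<in> L2" and lim: "\<And>e. e > 0 \<Longrightarrow> \<exists>g\<in>closed_span (*) S. Lsq (\<lambda>z. f z - g z) < e"
  shows "f \<in> closed_span (*) S"
  unfolding closed_span_iff
proof (intro conjI allI impI f)
  fix e :: real assume "e > 0"
  then have e: "e / 4 > 0" by simp
  obtain g where g: "g \<in> closed_span (*) S" "Lsq (\<lambda>z. f z - g z) < e / 4" using lim[OF e] by blast
  then obtain h where h: "h \<in> lin_span (*) S" "Lsq (\<lambda>z. g z - h z) < e / 4"
    using e unfolding closed_span_iff by blast
  have "g \<in> L2" "h \<in> L2" using g h lin_span_scalar_L2[OF S] closed_span_L2 by blast+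
  from Lsq_triangle[OF f this(2,1)] g h show "\<exists>g\<in>lin_span (*) S. Lsq (\<lambda>z. f z - g z) < e"
    by (intro bexI[of _ h]) auto
qed

lemma closed_span_add:
  assumes f: "f \<in> closed_span (*) S" and g: "g \<in> closed_span (*) S"
  shows "(\<lambda>z. f z + g z) \<in> closed_span (*) S"
  unfolding closed_span_iff
proof (intro conjI allI impI)
  have L: "f \<in> L2" "g \<in> L2" using f g closed_span_L2 by blast+
  then show "(\<lambda>z. f z + g z) \<in> L2" by (rule L2_add)
  fix e :: real assume "e > 0"
  then have e: "e / 4 > 0" by simp
  obtain f' where f': "f' \<in> lin_span (*) S" "Lsq (\<lambda>z. f z - f' z) < e / 4"
    using f e unfolding closed_span_iff by blast
  obtain g' where g': "g' \<in> lin_span (*) S" "Lsq (\<lambda>z. g z - g' z) < e / 4"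
    using g e unfolding closed_span_iff by blast
  have "f' \<in> L2" "g' \<in> L2" using f' g' lin_span_scalar_L2[OF S] by blast+
  from Lsq_add_le[OF L2_diff[OF L(1) this(1)] L2_diff[OF L(2) this(2)]] f'(2) g'(2)
  have "Lsq (\<lambda>z. (f z + g z) - (f' z + g' z)) < e" by (simp add: add_diff_add)
  then show "\<exists>h\<in>lin_span (*) S. Lsq (\<lambda>z. (f z + g z) - h z) < e"
    by (intro bexI[of _ "\<lambda>z. f' z + g' z"] lin_span_add f' g')
qed

lemma closed_span_cmult:
  assumes f: "f \<in> closed_span (*) S"
  shows "(\<lambda>z. c * f z) \<in> closed_span (*) S"
  unfolding closed_span_iff
proof (intro conjI allI impI)
  have L: "f \<in> L2" using f closed_span_L2 by blast
  then show "(\<lambda>z. c * f z) \<in> L2" by (rule L2_cmult)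
  fix e :: real assume e: "e > 0"
  define k where "k = (norm c)\<^sup>2 + 1"
  have k: "k > 0" "(norm c)\<^sup>2 \<le> k" by (simp_all add: k_def add_nonneg_pos)
  obtain g where g: "g \<in> lin_span (*) S" "Lsq (\<lambda>z. f z - g z) < e / k"
    using f e k unfolding closed_span_iff by (meson divide_pos_pos)
  have "g \<in> L2" using g lin_span_scalar_L2[OF S] by blast
  then have "Lsq (\<lambda>z. c * (f z - g z)) \<le> (norm c)\<^sup>2 * Lsq (\<lambda>z. f z - g z)"
    by (intro Lsq_mult_le L2_diff L) auto
  also have "\<dots> \<le> k * Lsq (\<lambda>z. f z - g z)" using k Lsq_nonneg by (intro mult_right_mono) auto
  also have "\<dots> < e" using g k by (simp add: pos_less_divide_eq mult.commute)
  finally have "Lsq (\<lambda>z. c * f z - c * g z) < e" by (simp add: right_diff_distrib)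
  then show "\<exists>h\<in>lin_span (*) S. Lsq (\<lambda>z. c * f z - h z) < e"
    by (intro bexI[of _ "\<lambda>z. c * g z"] lin_span_cmult g)
qed

lemma closed_span_zero: "(\<lambda>z. 0) \<in> closed_span (*) S"
proof -
  have "(\<lambda>z. 0) \<in> lin_span (*) S"
    unfolding lin_span_def by (intro CollectI exI[of _ "{}"]) auto
  then show ?thesis using lin_span_closed_span[of "(*)" S] S by (auto intro: bounded_linear_mult_right)
qed

lemma closed_span_cong_AE:
  assumes f: "f \<in> borel_measurable borel" and g: "g \<in> closed_span (*) S"
    and eq: "AE z in arc_measure. f z = g z"
  shows "f \<in> closed_span (*) S"
proof (rule closed_span_limit)
  have gL: "g \<in> L2" using g closed_span_L2 by blast
  then show "f \<in> L2" by (rule L2_cong_AE[OF f _ eq])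
  note [measurable] = f L2_measurable[OF gL]
  have "Lsq (\<lambda>z. f z - g z) = Lsq (\<lambda>z. 0 :: complex)"
    by (rule Lsq_cong_AE) (use eq in \<open>auto elim!: eventually_mono\<close>)
  then show "\<exists>g\<in>closed_span (*) S. Lsq (\<lambda>z. f z - g z) < e" if "e > 0" for e
    using that g by (intro bexI[of _ g]) (auto simp: Lsq_def)
qed

lemma closed_span_projection:
  assumes f: "f \<in> L2"
  shows "\<exists>p\<in>closed_span (*) S. \<forall>m\<in>closed_span (*) S.
    (LINT z|arc_measure. (f z - p z) * cnj (m z)) = 0"
  by (rule L2_projection[OF closed_span_L2 closed_span_zero closed_span_add closed_span_cmult closed_span_limit f])

text \<open>Multiplication by a bounded function is linear and \<open>L2\<close>-continuous, so
  inclusion of the images of the generators passes to the closed span.\<close>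

lemma closed_span_mult_into:
  assumes S': "S' \<subseteq> L2"
    and m: "m \<in> borel_measurable borel" and bd: "AE z in arc_measure. norm (m z) \<le> C"
    and gen: "\<And>g. g \<in> S' \<Longrightarrow> (\<lambda>z. m z * g z) \<in> closed_span (*) S"
    and f: "f \<in> closed_span (*) S'"
  shows "(\<lambda>z. m z * f z) \<in> closed_span (*) S"
proof (rule closed_span_limit)
  have L: "f \<in> L2" using f closed_span_L2 by blast
  show "(\<lambda>z. m z * f z) \<in> L2" by (rule Lsq_mult_le[OF L m bd])
  have span: "(\<lambda>z. m z * g z) \<in> closed_span (*) S" if gS: "g \<in> lin_span (*) S'" for g
  proof -
    obtain T c where T: "finite T" "T \<subseteq> S'" "g = (\<lambda>z. \<Sum>h\<in>T. c h * h z)"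
      using gS by (auto simp: lin_span_def)
    have "(\<lambda>z. \<Sum>h\<in>T. c h * (m z * h z)) \<in> closed_span (*) S"
      using T(1,2) by (induction T) (simp_all add: closed_span_zero closed_span_add closed_span_cmult gen)
    then show ?thesis by (simp add: T(3) sum_distrib_left mult_ac)
  qed
  fix e :: real assume e: "e > 0"
  define k where "k = C\<^sup>2 + 1"
  have k: "k > 0" "C\<^sup>2 \<le> k" by (simp_all add: k_def add_nonneg_pos)
  obtain g where g: "g \<in> lin_span (*) S'" "Lsq (\<lambda>z. f z - g z) < e / k"
    using f e k unfolding closed_span_iff by (meson divide_pos_pos)
  have "g \<in> L2" using g lin_span_scalar_L2[OF S'] by blast
  then have "Lsq (\<lambda>z. m z * (f z - g z)) \<le> C\<^sup>2 * Lsq (\<lambda>z. f z - g z)"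
    by (intro Lsq_mult_le L2_diff L m bd)
  also have "\<dots> \<le> k * Lsq (\<lambda>z. f z - g z)" using k Lsq_nonneg by (intro mult_right_mono) auto
  also have "\<dots> < e" using g k by (simp add: pos_less_divide_eq mult.commute)
  finally have "Lsq (\<lambda>z. m z * f z - m z * g z) < e" by (simp add: right_diff_distrib)
  then show "\<exists>h\<in>closed_span (*) S. Lsq (\<lambda>z. m z * f z - h z) < e"
    by (intro bexI[of _ "\<lambda>z. m z * g z"] span g)
qed

end

section \<open>Hardy spaces\<close>

text \<open>Bounded multipliers that need not be analytic. Conjugates of inner functions belong
  here, and multiplying by them is division on the circle.\<close>

definition Linf :: "(complex \<Rightarrow> complex) set" where
  "Linf = {f \<in> borel_measurable borel. \<exists>C. AE z in arc_measure. norm (f z) \<le> C}"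

lemma LinfI: "f \<in> borel_measurable borel \<Longrightarrow> AE z in arc_measure. norm (f z) \<le> C \<Longrightarrow> f \<in> Linf"
  by (auto simp: Linf_def)

lemma LinfE:
  assumes "f \<in> Linf"
  obtains C where "f \<in> borel_measurable borel" "AE z in arc_measure. norm (f z) \<le> C"
  using assms by (auto simp: Linf_def)

lemma Linf_measurable: "f \<in> Linf \<Longrightarrow> f \<in> borel_measurable borel"
  by (simp add: Linf_def)

lemma Linf_mult:
  assumes "f \<in> Linf" "g \<in> Linf"
  shows "(\<lambda>z. f z * g z) \<in> Linf"
proof -
  obtain C where [measurable]: "f \<in> borel_measurable borel" and C: "AE z in arc_measure. norm (f z) \<le> C"
    using LinfE[OF assms(1)] by blast
  obtain D where [measurable]: "g \<in> borel_measurable borel" and D: "AE z in arc_measure. norm (g z) \<le> D"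
    using LinfE[OF assms(2)] by blast
  show ?thesis
  proof (rule LinfI)
    show "AE z in arc_measure. norm (f z * g z) \<le> C * D"
      using C D by eventually_elim (simp add: norm_mult mult_mono')
  qed measurable
qed

lemma Linf_cnj: "f \<in> Linf \<Longrightarrow> (\<lambda>z. cnj (f z)) \<in> Linf"
  by (auto simp: Linf_def)

lemma Linf_const: "(\<lambda>z. c) \<in> Linf"
  by (auto simp: Linf_def)

lemma Linf_add:
  assumes "f \<in> Linf" "g \<in> Linf"
  shows "(\<lambda>z. f z + g z) \<in> Linf"
proof -
  obtain C where [measurable]: "f \<in> borel_measurable borel" and C: "AE z in arc_measure. norm (f z) \<le> C"
    using LinfE[OF assms(1)] by blast
  obtain D where [measurable]: "g \<in> borel_measurable borel" and D: "AE z in arc_measure. norm (g z) \<le> D"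
    using LinfE[OF assms(2)] by blast
  show ?thesis
  proof (rule LinfI)
    show "AE z in arc_measure. norm (f z + g z) \<le> C + D"
      using C D by eventually_elim (rule norm_triangle_mono)
  qed measurable
qed

lemma Linf_sum: "(\<And>i. i \<in> I \<Longrightarrow> f i \<in> Linf) \<Longrightarrow> (\<lambda>z. \<Sum>i\<in>I. f i z) \<in> Linf"
  by (induction I rule: infinite_finite_induct) (simp_all add: Linf_add Linf_const)

lemma Linf_power: "(\<lambda>z. z ^ k) \<in> Linf"
proof (rule LinfI)
  show "AE z in arc_measure. norm (z ^ k) \<le> 1"
    using AE_arc_norm by eventually_elim (simp add: norm_power)
qed measurable

lemma Linf_mult_L2: "m \<in> Linf \<Longrightarrow> f \<in> L2 \<Longrightarrow> (\<lambda>z. m z * f z) \<in> L2"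
  by (auto simp: Linf_def intro: Lsq_mult_le(1))

lemma Linf_L2: "f \<in> Linf \<Longrightarrow> f \<in> L2"
  using Linf_mult_L2[of f "\<lambda>z. 1"] by (simp add: L2_def)

lemma H2_L2: "f \<in> H2 \<Longrightarrow> f \<in> L2"
  by (simp add: H2_def)

lemma H2_measurable: "f \<in> H2 \<Longrightarrow> f \<in> borel_measurable borel"
  by (simp add: H2_L2 L2_measurable)

lemma H2_coeff: "f \<in> H2 \<Longrightarrow> k \<ge> 1 \<Longrightarrow> (LINT z|arc_measure. f z * z ^ k) = 0"
  by (simp add: H2_def)

lemma H2_cong_AE:
  assumes f: "f \<in> borel_measurable borel" and g: "g \<in> H2" and eq: "AE z in arc_measure. f z = g z"
  shows "f \<in> H2"
proof -
  note [measurable] = f H2_measurable[OF g]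
  have "(LINT z|arc_measure. f z * z ^ k) = (LINT z|arc_measure. g z * z ^ k)" for k
    by (rule integral_cong_AE) (use eq in \<open>auto elim!: eventually_mono\<close>)
  then show ?thesis using L2_cong_AE[OF f H2_L2[OF g] eq] g by (simp add: H2_def)
qed

lemma H2_add: "f \<in> H2 \<Longrightarrow> g \<in> H2 \<Longrightarrow> (\<lambda>z. f z + g z) \<in> H2"
  by (simp add: H2_def L2_add distrib_right integrable_mult_power L2_integrable)

lemma H2_cmult: "f \<in> H2 \<Longrightarrow> (\<lambda>z. c * f z) \<in> H2"
  by (simp add: H2_def L2_cmult mult.assoc)

lemma H2_zero: "(\<lambda>z. 0) \<in> H2"
  by (simp add: H2_def)

lemma H2_sum: "(\<And>i. i \<in> I \<Longrightarrow> f i \<in> H2) \<Longrightarrow> (\<lambda>z. \<Sum>i\<in>I. f i z) \<in> H2"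
  by (induction I rule: infinite_finite_induct) (simp_all add: H2_add H2_zero)

lemma H2_mult_power: "f \<in> H2 \<Longrightarrow> (\<lambda>z. f z * z ^ k) \<in> H2"
  using Linf_mult_L2[OF Linf_power[of k], of f]
  by (simp add: H2_def mult.assoc power_add[symmetric] mult.commute[of "_ ^ k"])

lemma H2_const: "(\<lambda>z. c) \<in> H2"
  by (simp add: H2_def integral_arc_power Linf_L2 Linf_const)

lemma H2_power: "(\<lambda>z. z ^ k) \<in> H2"
  using H2_mult_power[OF H2_const[of 1]] by simp

lemma Hinf_iff: "f \<in> Hinf \<longleftrightarrow> f \<in> H2 \<and> f \<in> Linf"
  by (auto simp: Hinf_def Linf_def H2_measurable)

text \<open>The basic division tool. For each \<open>k \<ge> 1\<close> the coefficient of
  \<open>m f\<close> of index \<open>-k\<close> is a continuous functional of \<open>f\<close> that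
  vanishes on the generators.\<close>

lemma closed_span_mult_H2:
  assumes m: "m \<in> Linf" and S: "S \<subseteq> L2" and gen: "\<And>g. g \<in> S \<Longrightarrow> (\<lambda>z. m z * g z) \<in> H2"
    and f: "f \<in> closed_span (*) S"
  shows "(\<lambda>z. m z * f z) \<in> H2"
proof -
  have L: "(\<lambda>z. m z * f z) \<in> L2"
    using f closed_span_L2 by (intro Linf_mult_L2[OF m]) blast
  have "(LINT z|arc_measure. m z * f z * z ^ k) = 0" if k: "k \<ge> 1" for k
  proof -
    obtain C where C: "(\<lambda>z. m z * z ^ k) \<in> borel_measurable borel" "AE z in arc_measure. norm (m z * z ^ k) \<le> C"
      using LinfE[OF Linf_mult[OF m Linf_power]] by blast
    note [measurable] = C(1)
    have "(LINT z|arc_measure. (m z * z ^ k) * f z) = 0"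
    proof (rule closed_span_functional[OF bounded_linear_mult_right S _ _ _ _ _ f, where a = "\<lambda>z v. (m z * z ^ k) * v"])
      show "AE z in arc_measure. \<forall>v. norm (m z * z ^ k * v) \<le> C * norm v"
        using C(2) by eventually_elim (auto simp: norm_mult intro!: mult_right_mono)
      show "(LINT z|arc_measure. m z * z ^ k * g z) = 0" if "g \<in> S" for g
        using gen[OF that] k by (simp add: H2_def mult_ac)
      show "linear ((*) (m z * z ^ k))" for z by (rule bounded_linear.linear[OF bounded_linear_mult_right])
    qed (auto simp: mult_ac)
    then show ?thesis by (simp add: mult_ac)
  qed
  then show ?thesis using L by (simp add: H2_def)
qed

text \<open>Let \<open>p\<close> be the projection of \<open>h\<close> onto the span of the powers.
  The residual has no negative frequencies, since \<open>h\<close> and \<open>p\<close> lie in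
  \<open>H2\<close>, and no nonnegative ones by orthogonality, so it is null.\<close>

lemma H2_subset_closed_span_powers: "H2 \<subseteq> closed_span (*) (range (\<lambda>k z. z ^ k))"
proof
  let ?S = "range (\<lambda>(k::nat) (z::complex). z ^ k)"
  fix h assume h: "h \<in> H2"
  have S: "?S \<subseteq> L2" using H2_L2[OF H2_power] by auto
  obtain p where p: "p \<in> closed_span (*) ?S"
    and orth: "\<And>m. m \<in> closed_span (*) ?S \<Longrightarrow> (LINT z|arc_measure. (h z - p z) * cnj (m z)) = 0"
    using closed_span_projection[OF S H2_L2[OF h]] by blast
  have pH: "p \<in> H2"
    using closed_span_mult_H2[OF Linf_const[of 1] S _ p] H2_power by auto
  have d: "(\<lambda>z. h z - p z) \<in> H2" using H2_add[OF h H2_cmult[OF pH, of "-1"]] by simp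
  have "(LINT z|arc_measure. (h z - p z) * cnj z ^ k) = 0" for k
    using orth[of "\<lambda>z. z ^ k"] closed_span_superset[OF S] by auto
  moreover have "(LINT z|arc_measure. (h z - p z) * z ^ k) = 0" for k
    using d calculation[of 0] by (cases k) (auto simp: H2_def simp del: power_Suc)
  ultimately have "zero_coeffs (\<lambda>z. h z - p z)"
    using L2_integrable[OF H2_L2[OF d]] by (simp add: zero_coeffs_def)
  from zero_coeffs_AE_zero[OF this] show "h \<in> closed_span (*) ?S"
    by (intro closed_span_cong_AE[OF S H2_measurable[OF h] p]) (auto elim!: eventually_mono)
qed

text \<open>It suffices to multiply \<open>m\<close> by powers of \<open>z\<close>, since these span
  \<open>H2\<close>.\<close>

lemma Hinf_mult_H2:
  assumes m: "m \<in> Hinf" and h: "h \<in> H2"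
  shows "(\<lambda>z. m z * h z) \<in> H2"
proof (rule closed_span_mult_H2)
  show "h \<in> closed_span (*) (range (\<lambda>k z. z ^ k))" using h H2_subset_closed_span_powers by blast
  show "range (\<lambda>k (z::complex). z ^ k) \<subseteq> L2" using H2_L2[OF H2_power] by auto
qed (use m in \<open>auto simp: Hinf_iff intro: H2_mult_power\<close>)

lemma Hinf_mult: "f \<in> Hinf \<Longrightarrow> g \<in> Hinf \<Longrightarrow> (\<lambda>z. f z * g z) \<in> Hinf"
  using Hinf_mult_H2 by (simp add: Hinf_iff Linf_mult)

lemma Hinf_sum: "(\<And>i. i \<in> I \<Longrightarrow> f i \<in> Hinf) \<Longrightarrow> (\<lambda>z. \<Sum>i\<in>I. f i z) \<in> Hinf"
  by (simp add: Hinf_iff H2_sum Linf_sum)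

lemma Hinf_zero: "(\<lambda>z. 0) \<in> Hinf"
  by (simp add: Hinf_iff H2_zero Linf_const)

text \<open>All coefficients of nonzero index vanish, the negative ones directly and the positive
  ones through the conjugate; subtracting the mean removes the remaining one.\<close>

lemma AE_eq_integral:
  assumes g: "integrable arc_measure g"
    and "\<And>k. k \<ge> 1 \<Longrightarrow> (LINT z|arc_measure. g z * z ^ k) = 0"
    and "\<And>k. k \<ge> 1 \<Longrightarrow> (LINT z|arc_measure. cnj (g z) * z ^ k) = 0"
  shows "AE z in arc_measure. g z = (LINT z|arc_measure. g z)"
proof -
  define c where "c = (LINT z|arc_measure. g z)"
  have c0: "(LINT z|arc_measure. c * z ^ k) = 0" if "k \<ge> 1" for k
    using that by (simp add: integral_arc_power)
  have ck: "integrable arc_measure (\<lambda>z. c * z ^ k)" "integrable arc_measure (\<lambda>z. c * cnj z ^ k)" for k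
    by (rule integrable_mult_power; simp)+
  have 1: "(LINT z|arc_measure. (g z - c) * z ^ k) = 0" for k
    using g c0[of k] assms(2)[of k] integrable_mult_power(1)[OF g, of k] ck(1)[of k]
    by (cases "k = 0") (simp_all add: c_def[symmetric] left_diff_distrib)
  have 2: "(LINT z|arc_measure. (g z - c) * cnj z ^ k) = 0" for k
  proof (cases "k = 0")
    case False
    have "(LINT z|arc_measure. g z * cnj z ^ k) = (LINT z|arc_measure. cnj (cnj (g z) * z ^ k))"
      by simp
    also have "\<dots> = cnj (LINT z|arc_measure. cnj (g z) * z ^ k)" by (rule Bochner_Integration.integral_cnj)
    also have "\<dots> = 0" using assms(3)[of k] False by simp
    finally have "(LINT z|arc_measure. g z * cnj z ^ k) = 0" .
    moreover have "(LINT z|arc_measure. c * cnj z ^ k) = cnj (LINT z|arc_measure. cnj c * z ^ k)"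
      by (simp only: Bochner_Integration.integral_cnj[symmetric]) simp
    ultimately show ?thesis
      using integrable_mult_power(2)[OF g, of k] ck(2)[of k] integral_arc_power[of k] False
      by (simp add: left_diff_distrib)
  qed (use 1[of 0] in simp)
  have "zero_coeffs (\<lambda>z. g z - c)" using g 1 2 by (simp add: zero_coeffs_def)
  from zero_coeffs_AE_zero[OF this] show ?thesis by (simp add: c_def)
qed

lemma H2_cnj_H2_constant:
  assumes "f \<in> H2" and "(\<lambda>z. cnj (f z)) \<in> H2"
  shows "\<exists>c. AE z in arc_measure. f z = c"
  using AE_eq_integral[of f] L2_integrable[OF H2_L2[OF assms(1)]] assms by (auto simp: H2_def)

section \<open>Scalar inner functions and existence of greatest common divisors\<close>

lemma scalar_inner_Hinf: "scalar_inner \<theta> \<Longrightarrow> \<theta> \<in> Hinf"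
  by (simp add: scalar_inner_def)

lemma scalar_inner_Linf: "scalar_inner \<theta> \<Longrightarrow> \<theta> \<in> Linf"
  by (simp add: scalar_inner_def Hinf_iff)

lemma scalar_inner_H2: "scalar_inner \<theta> \<Longrightarrow> \<theta> \<in> H2"
  by (simp add: scalar_inner_def Hinf_iff)

lemma scalar_inner_mult_cnj:
  assumes "scalar_inner \<theta>"
  shows "AE z in arc_measure. \<theta> z * cnj (\<theta> z) = 1"
  using assms unfolding scalar_inner_def
  by (auto elim!: eventually_mono simp: complex_norm_square[symmetric])

lemma Hinf_cong_AE:
  assumes f: "f \<in> borel_measurable borel" and g: "g \<in> Hinf" and eq: "AE z in arc_measure. f z = g z"
  shows "f \<in> Hinf"
proof -
  obtain C where "AE z in arc_measure. norm (g z) \<le> C" using g by (auto simp: Hinf_def)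
  with eq have "AE z in arc_measure. norm (f z) \<le> C" by eventually_elim simp
  then show ?thesis using H2_cong_AE[OF f _ eq] g by (auto simp: Hinf_def)
qed

lemma scalar_inner_one: "scalar_inner (\<lambda>z. 1)"
  by (simp add: scalar_inner_def Hinf_iff H2_const Linf_const)

text \<open>Since \<open>cnj (\<theta> z)\<close> inverts \<open>\<theta> z\<close> almost
  everywhere on the circle, the cofactor \<open>h\<close> is determined, and membership becomes a
  test for analyticity.\<close>

lemma scalar_range_iff:
  assumes \<theta>: "scalar_inner \<theta>"
  shows "f \<in> scalar_range \<theta> \<longleftrightarrow> f \<in> L2 \<and> (\<lambda>z. cnj (\<theta> z) * f z) \<in> H2"
proof -
  note [measurable] = Linf_measurable[OF scalar_inner_Linf[OF \<theta>]]
  have "(\<lambda>z. cnj (\<theta> z) * f z) \<in> H2"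
    if f: "f \<in> L2" and h: "h \<in> H2" and eq: "AE z in arc_measure. f z = \<theta> z * h z" for h
  proof (rule H2_cong_AE[OF _ h])
    note [measurable] = L2_measurable[OF f]
    show "(\<lambda>z. cnj (\<theta> z) * f z) \<in> borel_measurable borel" by measurable
    show "AE z in arc_measure. cnj (\<theta> z) * f z = h z"
      using scalar_inner_mult_cnj[OF \<theta>] eq
      by eventually_elim (metis mult.assoc mult.commute mult.right_neutral)
  qed
  moreover have "AE z in arc_measure. f z = \<theta> z * (cnj (\<theta> z) * f z)"
    using scalar_inner_mult_cnj[OF \<theta>] by eventually_elim (simp add: mult.assoc[symmetric])
  from bexI[where P = "\<lambda>h. AE z in arc_measure. f z = \<theta> z * h z", OF this] have "\<exists>h\<in>H2. AE z in arc_measure. f z = \<theta> z * h z" if "(\<lambda>z. cnj (\<theta> z) * f z) \<in> H2"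
    using that by blast
  ultimately show ?thesis by (auto simp: scalar_range_def)
qed

lemma scalar_range_H2:
  assumes \<theta>: "scalar_inner \<theta>"
  shows "scalar_range \<theta> \<subseteq> H2"
  using H2_cong_AE[OF _ Hinf_mult_H2[OF scalar_inner_Hinf[OF \<theta>]]]
  by (auto simp: scalar_range_def L2_measurable)

lemma scalar_range_mult_Hinf:
  assumes \<theta>: "scalar_inner \<theta>" and m: "m \<in> Hinf" and g: "g \<in> scalar_range \<theta>"
  shows "(\<lambda>z. m z * g z) \<in> scalar_range \<theta>"
proof -
  have "(\<lambda>z. m z * (cnj (\<theta> z) * g z)) \<in> H2"
    using g by (intro Hinf_mult_H2[OF m]) (simp add: scalar_range_iff[OF \<theta>])
  then show ?thesis
    using g m Linf_mult_L2[of m g] by (simp add: scalar_range_iff[OF \<theta>] Hinf_iff mult_ac)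
qed

lemma self_in_scalar_range:
  assumes \<theta>: "scalar_inner \<theta>"
  shows "\<theta> \<in> scalar_range \<theta>"
proof -
  have "\<exists>h\<in>H2. AE z in arc_measure. \<theta> z = \<theta> z * h z"
    by (rule bexI[of _ "\<lambda>z. 1"]) (simp_all add: H2_const)
  then show ?thesis by (simp add: scalar_range_def H2_L2 scalar_inner_H2[OF \<theta>])
qed

text \<open>It stands in for a Bezout identity, which coprime inner functions need not satisfy:
  \<open>d\<close> is a limit of combinations of multiples of the elements of \<open>S\<close>, and
  analyticity after multiplication by \<open>m\<close> survives limits.\<close>

lemma gcd_multiplier:
  assumes gcd: "is_gcd S d" and S: "\<And>\<theta>. \<theta> \<in> S \<Longrightarrow> scalar_inner \<theta>" and m: "m \<in> Linf"
    and gen: "\<And>\<theta>. \<theta> \<in> S \<Longrightarrow> (\<lambda>z. m z * \<theta> z) \<in> Hinf"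
  shows "(\<lambda>z. m z * d z) \<in> Hinf"
proof -
  have d: "scalar_inner d" "d \<in> closed_span (*) (\<Union>\<theta>\<in>S. scalar_range \<theta>)"
    using gcd self_in_scalar_range[of d] by (auto simp: is_gcd_def)
  have "(\<lambda>z. m z * d z) \<in> H2"
  proof (rule closed_span_mult_H2[OF m _ _ d(2)])
    show "(\<Union>\<theta>\<in>S. scalar_range \<theta>) \<subseteq> L2" by (auto simp: scalar_range_def)
    fix g assume "g \<in> (\<Union>\<theta>\<in>S. scalar_range \<theta>)"
    then obtain \<theta> h where \<theta>: "\<theta> \<in> S" and g: "g \<in> L2" and h: "h \<in> H2"
      and eq: "AE z in arc_measure. g z = \<theta> z * h z" by (auto simp: scalar_range_def)
    note [measurable] = L2_measurable[OF g] Linf_measurable[OF m]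
    show "(\<lambda>z. m z * g z) \<in> H2"
    proof (rule H2_cong_AE[OF _ Hinf_mult_H2[OF gen[OF \<theta>] h]])
      show "AE z in arc_measure. m z * g z = m z * \<theta> z * h z"
        using eq by eventually_elim simp
    qed measurable
  qed
  then show ?thesis using Linf_mult[OF m scalar_inner_Linf[OF d(1)]] by (simp add: Hinf_iff)
qed

lemma gcd_divides:
  assumes gcd: "is_gcd S d" and S: "\<And>\<theta>. \<theta> \<in> S \<Longrightarrow> scalar_inner \<theta>" and \<theta>: "\<theta> \<in> S"
  shows "(\<lambda>z. cnj (d z) * \<theta> z) \<in> Hinf"
proof -
  have d: "scalar_inner d" using gcd by (simp add: is_gcd_def)
  have "(\<Union>\<theta>\<in>S. scalar_range \<theta>) \<subseteq> L2" by (auto simp: scalar_range_def)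
  from closed_span_superset[OF this] have "\<theta> \<in> closed_span (*) (\<Union>\<theta>\<in>S. scalar_range \<theta>)"
    using \<theta> self_in_scalar_range[OF S[OF \<theta>]] by auto
  then have "\<theta> \<in> scalar_range d" using gcd by (simp add: is_gcd_def)
  then show ?thesis
    using Linf_mult[OF Linf_cnj[OF scalar_inner_Linf[OF d]] scalar_inner_Linf[OF S[OF \<theta>]]]
    by (simp add: scalar_range_iff[OF d] Hinf_iff)
qed

section \<open>Beurling's theorem\<close>

lemma z_mult_cnj_power: "norm z = 1 \<Longrightarrow> cnj z ^ Suc k * w * z = w * cnj z ^ k" for z :: complex
  using complex_norm_square[of z] by (simp add: mult_ac)

text \<open>The closed span \<open>M\<close> is a nonzero subspace of \<open>H2\<close> invariant
  under multiplication by \<open>z\<close>. The generator comes from the gap between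
  \<open>M\<close> and \<open>z M\<close>, and \<open>S \<noteq> {}\<close> guarantees an inner
  function in \<open>M\<close>, hence that this gap is nontrivial.\<close>

lemma gcd_exists:
  assumes S: "\<And>\<theta>. \<theta> \<in> S \<Longrightarrow> scalar_inner \<theta>" and ne: "S \<noteq> {}"
  shows "\<exists>d. is_gcd S d"
proof -
  define G where "G = (\<Union>\<theta>\<in>S. scalar_range \<theta>)"
  define M where "M = closed_span (*) G"
  have GH: "G \<subseteq> H2" using scalar_range_H2[OF S] by (auto simp: G_def)
  then have GL: "G \<subseteq> L2" using H2_L2 by auto
  have ML2: "M \<subseteq> L2" unfolding M_def by (rule closed_span_L2)
  have MH: "M \<subseteq> H2"
  proof
    fix f assume "f \<in> M"
    then show "f \<in> H2"
      using closed_span_mult_H2[OF Linf_const[of 1] GL, of f] GH by (auto simp: M_def)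
  qed
  have zH: "(\<lambda>z. z) \<in> Hinf" using H2_power[of 1] Linf_power[of 1] by (simp add: Hinf_iff)
  have zM: "(\<lambda>z. z * f z) \<in> M" if f: "f \<in> M" for f
    unfolding M_def
  proof (rule closed_span_mult_into[OF GL GL])
    show "AE z in arc_measure. norm z \<le> 1" using AE_arc_norm by eventually_elim simp
    show "(\<lambda>z. z * g z) \<in> closed_span (*) G" if "g \<in> G" for g
    proof (rule subsetD[OF closed_span_superset[OF GL]])
      show "(\<lambda>z. z * g z) \<in> G" using that scalar_range_mult_Hinf[OF S zH] by (auto simp: G_def)
    qed
  qed (use f in \<open>simp_all add: M_def\<close>)
  have zkM: "(\<lambda>z. z ^ k * f z) \<in> M" if f: "f \<in> M" for f k
  proof (induction k)
    case (Suc k)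
    from zM[OF this] show ?case by (simp add: mult.assoc)
  qed (use f in simp)
  \<comment> \<open>That is, \<open>z M\<close> is a proper subspace. Otherwise \<open>M\<close>
    would contain all \<open>cnj z ^ k * \<theta> z\<close>; since \<open>M\<close> lies in
    \<open>H2\<close>, every Fourier coefficient of \<open>\<theta>\<close> would vanish, against
    its modulus 1.\<close>
  have "\<exists>f\<in>M. (\<lambda>z. cnj z * f z) \<notin> M"
  proof (rule ccontr)
    assume *: "\<not> ?thesis"
    obtain \<theta> where \<theta>: "\<theta> \<in> S" using ne by blast
    then have "\<theta> \<in> M"
      using closed_span_superset[OF GL] self_in_scalar_range[OF S[OF \<theta>]] by (auto simp: M_def G_def)
    have pow: "(\<lambda>z. cnj z ^ k * \<theta> z) \<in> M" for k
    proof (induction k)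
      case (Suc k)
      then have "(\<lambda>z. cnj z * (cnj z ^ k * \<theta> z)) \<in> M" using * by (auto dest: bspec[of M _ "\<lambda>z. cnj z ^ k * \<theta> z"])
      then show ?case by (simp add: mult.assoc)
    qed (use \<open>\<theta> \<in> M\<close> in simp)
    note [measurable] = H2_measurable[OF scalar_inner_H2[OF S[OF \<theta>]]]
    have neg: "(LINT z|arc_measure. \<theta> z * cnj z ^ k) = 0" for k
    proof -
      \<comment> \<open>The coefficient of \<open>\<theta>\<close> of index \<open>k\<close> is the
        coefficient of index -1 of \<open>cnj z ^ Suc k * \<theta> z\<close>, an element of
        \<open>H2\<close>.\<close>
      have "(LINT z|arc_measure. \<theta> z * cnj z ^ k) = (LINT z|arc_measure. cnj z ^ Suc k * \<theta> z * z ^ 1)"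
        by (rule integral_cong_AE, measurable, use AE_arc_norm in eventually_elim)
          (simp add: z_mult_cnj_power del: power_Suc)
      also have "\<dots> = 0" using pow[of "Suc k"] MH by (intro H2_coeff) auto
      finally show ?thesis .
    qed
    have "(LINT z|arc_measure. \<theta> z * z ^ k) = 0" for k
      using neg[of 0] \<open>\<theta> \<in> M\<close> MH by (cases "k = 0") (auto simp: H2_def)
    with neg have "zero_coeffs \<theta>"
      using L2_integrable[OF H2_L2[OF scalar_inner_H2[OF S[OF \<theta>]]]] by (simp add: zero_coeffs_def)
    from zero_coeffs_AE_zero[OF this] scalar_inner_mult_cnj[OF S[OF \<theta>]]
    have "AE z in arc_measure. False" by eventually_elim simp
    then show False by simp
  qed
  then obtain f where f: "f \<in> M" and nf: "(\<lambda>z. cnj z * f z) \<notin> M" by blast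
  note [measurable] = H2_measurable[OF subsetD[OF MH f]]
  have zfL: "(\<lambda>z. cnj z * f z) \<in> L2"
    using Linf_mult_L2[OF Linf_cnj[OF Linf_power[of 1]]] f ML2 by auto
  \<comment> \<open>Projecting \<open>cnj z * f z\<close> onto \<open>M\<close> amounts to
    projecting \<open>f\<close> onto \<open>z M\<close>, because multiplication by \<open>z\<close>
    is isometric; it has the advantage that \<open>M\<close> is a closed span by definition.\<close>
  obtain p where p: "p \<in> M"
    and orth: "\<And>m. m \<in> M \<Longrightarrow> (LINT z|arc_measure. (cnj z * f z - p z) * cnj (m z)) = 0"
    using closed_span_projection[OF GL zfL] unfolding M_def by blast
  note [measurable] = H2_measurable[OF subsetD[OF MH p]]
  txt \<open>Beurling: a vector of \<open>M\<close> orthogonal to \<open>z M\<close> has constant modulus and generates \<open>M\<close>.\<close>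
  define r where "r z = f z - z * p z" for z
  have rM: "r \<in> M"
    using closed_span_add[OF GL f[unfolded M_def] closed_span_cmult[OF GL zM[OF p, unfolded M_def], of "-1"]]
    by (simp add: M_def r_def[abs_def])
  have rH: "r \<in> H2" using rM MH by blast
  note [measurable] = H2_measurable[OF rH]
  have r_orth: "(LINT z|arc_measure. cnj (r z) * (z * m z)) = 0" if m: "m \<in> M" for m
  proof -
    note [measurable] = H2_measurable[OF subsetD[OF MH m]]
    have "(LINT z|arc_measure. cnj (r z) * (z * m z))
      = (LINT z|arc_measure. cnj ((cnj z * f z - p z) * cnj (m z)))"
    proof (rule integral_cong_AE, measurable, use AE_arc_mult_cnj in eventually_elim)
      case (elim z)
      have "cnj (r z) * (z * m z) = (z * cnj (f z) - (z * cnj z) * cnj (p z)) * m z"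
        by (simp add: r_def algebra_simps)
      then show ?case by (simp add: elim)
    qed
    also have "\<dots> = cnj (LINT z|arc_measure. (cnj z * f z - p z) * cnj (m z))"
      by (rule Bochner_Integration.integral_cnj)
    finally show ?thesis by (simp add: orth[OF m])
  qed
  have r_orth_pow: "(LINT z|arc_measure. cnj (r z) * m z * z ^ k) = 0" if "m \<in> M" "k \<ge> 1" for m k
    using r_orth[OF zkM[OF that(1), of "k - 1"]] that(2) by (cases k) (auto simp: mult_ac)
  define \<rho> where "\<rho> = Lsq r"
  \<comment> \<open>All frequencies of the squared modulus except 0 vanish: \<open>r\<close> is
    orthogonal to \<open>z ^ k * r z\<close> for \<open>k \<ge> 1\<close>, and the squared modulus
    is real.\<close>
  have "AE z in arc_measure. cnj (r z) * r z = (LINT z|arc_measure. cnj (r z) * r z)"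
  proof (rule AE_eq_integral)
    show "integrable arc_measure (\<lambda>z. cnj (r z) * r z)"
      by (intro L2_mult_integrable L2_cnj H2_L2[OF rH])
    show "(LINT z|arc_measure. cnj (r z) * r z * z ^ k) = 0" if "k \<ge> 1" for k
      by (rule r_orth_pow[OF rM that])
    then show "(LINT z|arc_measure. cnj (cnj (r z) * r z) * z ^ k) = 0" if "k \<ge> 1" for k
      using that by (simp add: mult_ac)
  qed
  moreover have rr: "cnj (r z) * r z = of_real ((norm (r z))\<^sup>2)" for z
    by (simp only: complex_norm_square mult.commute)
  moreover have "(LINT z|arc_measure. complex_of_real ((norm (r z))\<^sup>2)) = of_real \<rho>"
    unfolding \<rho>_def Lsq_def by (rule integral_complex_of_real)
  ultimately have "AE z in arc_measure. complex_of_real ((norm (r z))\<^sup>2) = of_real \<rho>"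
    by (simp only:)
  then have r\<rho>: "AE z in arc_measure. (norm (r z))\<^sup>2 = \<rho>"
    by eventually_elim (simp only: of_real_eq_iff)
  \<comment> \<open>A vanishing residual would put \<open>cnj z * f z\<close> into \<open>M\<close>,
    which the choice of \<open>f\<close> excludes.\<close>
  have "\<rho> \<noteq> 0"
  proof
    assume "\<rho> = 0"
    with r\<rho> have "AE z in arc_measure. r z = 0" by (auto elim!: eventually_mono)
    then have "AE z in arc_measure. cnj z * f z = p z"
      using AE_arc_mult_cnj
    proof eventually_elim
      case (elim z)
      then have "cnj z * f z = (z * cnj z) * p z" by (simp add: r_def mult_ac)
      then show ?case by (simp add: elim)
    qed
    then have "(\<lambda>z. cnj z * f z) \<in> M"
      unfolding M_def by (intro closed_span_cong_AE[OF GL _ p[unfolded M_def]]) measurable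
    then show False using nf by simp
  qed
  then have \<rho>: "\<rho> > 0" using Lsq_nonneg[of r] by (simp add: \<rho>_def)
  define \<phi> where "\<phi> z = of_real (1 / sqrt \<rho>) * r z" for z
  have \<phi>M: "\<phi> \<in> M"
    unfolding M_def \<phi>_def by (rule closed_span_cmult[OF GL rM[unfolded M_def]])
  have norm\<phi>: "AE z in arc_measure. norm (\<phi> z) = 1"
    using r\<rho> by eventually_elim (use \<rho> in \<open>auto simp: \<phi>_def norm_mult norm_divide real_sqrt_unique\<close>)
  have inner: "scalar_inner \<phi>"
  proof -
    have "AE z in arc_measure. norm (\<phi> z) \<le> 1" using norm\<phi> by eventually_elim simp
    then show ?thesis using norm\<phi> \<phi>M MH by (auto simp: scalar_inner_def Hinf_def)
  qed
  have "scalar_range \<phi> = M"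
  proof (intro equalityI subsetI)
    fix g assume "g \<in> scalar_range \<phi>"
    then obtain h where g: "g \<in> L2" and h: "h \<in> H2" and eq: "AE z in arc_measure. g z = \<phi> z * h z"
      by (auto simp: scalar_range_def)
    have "(\<lambda>z. \<phi> z * h z) \<in> M"
      unfolding M_def
    proof (rule closed_span_mult_into[OF GL])
      show "range (\<lambda>k (z::complex). z ^ k) \<subseteq> L2" using H2_L2[OF H2_power] by auto
      show "h \<in> closed_span (*) (range (\<lambda>k z. z ^ k))" using h H2_subset_closed_span_powers by blast
      show "AE z in arc_measure. norm (\<phi> z) \<le> 1" using norm\<phi> by eventually_elim simp
      show "(\<lambda>z. \<phi> z * g z) \<in> closed_span (*) G" if "g \<in> range (\<lambda>k z. z ^ k)" for g
        using that zkM[OF \<phi>M] by (auto simp: M_def mult.commute)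
    qed (rule H2_measurable[OF scalar_inner_H2[OF inner]])
    then show "g \<in> M"
      unfolding M_def by (intro closed_span_cong_AE[OF GL L2_measurable[OF g] _ eq])
  next
    fix g assume g: "g \<in> M"
    have L: "(\<lambda>z. cnj (\<phi> z) * g z) \<in> L2"
      using g ML2 by (intro Linf_mult_L2[OF Linf_cnj[OF scalar_inner_Linf[OF inner]]]) blast
    \<comment> \<open>Orthogonality of \<open>r\<close> to \<open>z M\<close>, read as the absence
      of negative frequencies in \<open>cnj (\<phi> z) * g z\<close>.\<close>
    have "(LINT z|arc_measure. cnj (\<phi> z) * g z * z ^ k) = 0" if "k \<ge> 1" for k
      using r_orth_pow[OF g that] by (simp add: \<phi>_def mult.assoc)
    then show "g \<in> scalar_range \<phi>"
      using L g ML2 by (auto simp: scalar_range_iff[OF inner] H2_def)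
  qed
  then show ?thesis using inner by (auto simp: is_gcd_def M_def G_def)
qed

section \<open>Matrix-valued functions\<close>

definition Linf_mat :: "(complex \<Rightarrow> complex ^ 'n ^ 'n) set" where
  "Linf_mat = {F. \<forall>i j. (\<lambda>z. F z $ i $ j) \<in> Linf}"

lemma mat_mult_nth: "(mat c ** A) $ i $ j = c * A $ i $ j" for A :: "complex ^ 'n ^ 'n"
proof -
  have "(mat c ** A) $ i $ j = (\<Sum>k\<in>UNIV. if k = i then c * A $ i $ j else 0)"
    unfolding matrix_matrix_mult_def mat_def vec_lambda_beta by (rule sum.cong) auto
  then show ?thesis by simp
qed

lemma mult_mat_nth: "(A ** mat c) $ i $ j = A $ i $ j * c" for A :: "complex ^ 'n ^ 'n"
proof -
  have "(A ** mat c) $ i $ j = (\<Sum>k\<in>UNIV. if k = j then A $ i $ j * c else 0)"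
    unfolding matrix_matrix_mult_def mat_def vec_lambda_beta by (rule sum.cong) auto
  then show ?thesis by simp
qed

lemma mat_nth: "mat c $ i $ j = (if i = j then c else 0)"
  by (simp add: mat_def)

text \<open>Scalar matrices are central; this lets scalar inner functions be moved past the
  noncommuting factors.\<close>

lemma mult_mat_commute: "A ** mat c = mat c ** A" for A :: "complex ^ 'n ^ 'n"
  by (simp add: vec_eq_iff mult_mat_nth mat_mult_nth mult.commute)

lemma mat_mult_mat: "mat c ** mat d = mat (c * d)" for c d :: complex
  by (simp add: vec_eq_iff mat_mult_nth mat_nth)

lemma adjoint_mat_nth: "adjoint_mat A $ i $ j = cnj (A $ j $ i)"
  by (simp add: adjoint_mat_def)

lemma adjoint_mat_mult: "adjoint_mat (mat c ** A) = mat (cnj c) ** adjoint_mat A"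
  by (simp add: vec_eq_iff adjoint_mat_nth mat_mult_nth)

lemma unitary_mat_scale:
  assumes A: "unitary_mat A" and c: "c * cnj c = 1"
  shows "unitary_mat (mat c ** A)"
proof -
  have "(mat c ** A) ** (mat (cnj c) ** adjoint_mat A) = mat (c * cnj c) ** (A ** adjoint_mat A)"
    by (metis matrix_mul_assoc mult_mat_commute mat_mult_mat)
  moreover have "(mat (cnj c) ** adjoint_mat A) ** (mat c ** A) = mat (c * cnj c) ** (adjoint_mat A ** A)"
    by (metis matrix_mul_assoc mult_mat_commute mat_mult_mat)
  ultimately show ?thesis using A c by (simp add: unitary_mat_def adjoint_mat_mult)
qed

lemma Hinf_mat_nth: "F \<in> Hinf_mat \<Longrightarrow> (\<lambda>z. F z $ i $ j) \<in> Hinf"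
  by (simp add: Hinf_mat_def)

lemma Hinf_mat_Linf_mat: "F \<in> Hinf_mat \<Longrightarrow> F \<in> Linf_mat"
  by (simp add: Hinf_mat_def Linf_mat_def Hinf_iff)

lemma Linf_mat_nth: "F \<in> Linf_mat \<Longrightarrow> (\<lambda>z. F z $ i $ j) \<in> Linf"
  by (simp add: Linf_mat_def)

lemma Linf_mat_mult:
  assumes "F \<in> Linf_mat" "G \<in> Linf_mat"
  shows "(\<lambda>z. F z ** G z) \<in> Linf_mat"
  using assms by (simp add: Linf_mat_def matrix_matrix_mult_def Linf_sum Linf_mult)

lemma Hinf_mat_mult:
  assumes "F \<in> Hinf_mat" "G \<in> Hinf_mat"
  shows "(\<lambda>z. F z ** G z) \<in> Hinf_mat"
  using assms by (simp add: Hinf_mat_def matrix_matrix_mult_def Hinf_sum Hinf_mult)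

lemma Linf_mat_adjoint: "F \<in> Linf_mat \<Longrightarrow> (\<lambda>z. adjoint_mat (F z)) \<in> Linf_mat"
  by (simp add: Linf_mat_def adjoint_mat_nth Linf_cnj)

lemma Linf_mat_scale: "c \<in> Linf \<Longrightarrow> F \<in> Linf_mat \<Longrightarrow> (\<lambda>z. mat (c z) ** F z) \<in> Linf_mat"
  by (simp add: Linf_mat_def mat_mult_nth Linf_mult)

lemma Linf_mat_mat: "c \<in> Linf \<Longrightarrow> (\<lambda>z. mat (c z) :: complex ^ 'n ^ 'n) \<in> Linf_mat"
proof -
  assume c: "c \<in> Linf"
  have "(\<lambda>z. (mat (c z) :: complex ^ 'n ^ 'n) $ i $ j) \<in> Linf" for i j
    using c Linf_const[of 0] by (cases "i = j") (simp_all add: mat_nth)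
  then show ?thesis by (simp add: Linf_mat_def)
qed

lemma Hinf_mat_mat: "c \<in> Hinf \<Longrightarrow> (\<lambda>z. mat (c z) :: complex ^ 'n ^ 'n) \<in> Hinf_mat"
proof -
  assume c: "c \<in> Hinf"
  have "(\<lambda>z. (mat (c z) :: complex ^ 'n ^ 'n) $ i $ j) \<in> Hinf" for i j
    using c Hinf_zero by (cases "i = j") (simp_all add: mat_nth)
  then show ?thesis by (simp add: Hinf_mat_def)
qed

lemma Hinf_mat_scale: "c \<in> Hinf \<Longrightarrow> F \<in> Hinf_mat \<Longrightarrow> (\<lambda>z. mat (c z) ** F z) \<in> Hinf_mat"
  by (simp add: Hinf_mat_def mat_mult_nth Hinf_mult)

lemma Hinf_mat_cong_AE:
  assumes F: "F \<in> Linf_mat" and G: "G \<in> Hinf_mat" and eq: "AE z in arc_measure. F z = G z"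
  shows "F \<in> Hinf_mat"
proof -
  have "(\<lambda>z. F z $ i $ j) \<in> Hinf" for i j
    by (rule Hinf_cong_AE[OF Linf_measurable[OF Linf_mat_nth[OF F]] Hinf_mat_nth[OF G]])
      (use eq in \<open>auto elim!: eventually_mono\<close>)
  then show ?thesis by (simp add: Hinf_mat_def)
qed

section \<open>Closed spans of vector-valued functions\<close>

lemma bounded_linear_scale_vec: "bounded_linear ((*s) c)" for c :: complex
  unfolding linear_conv_bounded_linear[symmetric]
  by (rule linearI) (simp_all add: vec_eq_iff algebra_simps)

lemma L2_nth: "f \<in> L2 \<Longrightarrow> (\<lambda>z. f z $ i) \<in> L2" for f :: "complex \<Rightarrow> complex ^ 'n"
  by (rule L2_bounded_linear[OF bounded_linear_vec_nth])

lemma L2_vecI: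
  fixes f :: "complex \<Rightarrow> complex ^ 'n"
  assumes "\<And>i. (\<lambda>z. f z $ i) \<in> L2"
  shows "f \<in> L2"
proof -
  have "bounded_linear (axis i :: complex \<Rightarrow> complex ^ 'n)" for i
    unfolding linear_conv_bounded_linear[symmetric]
    by (rule linearI) (simp_all add: vec_eq_iff axis_def)
  then have "(\<lambda>z. \<Sum>i\<in>UNIV. (axis i (f z $ i) :: complex ^ 'n)) \<in> L2"
    by (intro L2_sum L2_bounded_linear[OF _ assms])
  moreover have "(\<Sum>i\<in>UNIV. axis i (v $ i)) = v" for v :: "complex ^ 'n"
    by (simp add: vec_eq_iff axis_def)
  ultimately show ?thesis by simp
qed

text \<open>The vector form of the division tool: each negative Fourier coefficient of each
  component of \<open>A f\<close> is a continuous functional of \<open>f\<close>, bounded through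
  the sum of the bounds on one row of \<open>A\<close>.\<close>

lemma closed_span_matrix_mult_H2:
  fixes A :: "complex \<Rightarrow> complex ^ 'n ^ 'n"
  assumes A: "A \<in> Linf_mat" and S: "S \<subseteq> L2"
    and gen: "\<And>g. g \<in> S \<Longrightarrow> (\<lambda>z. A z *v g z) \<in> H2_vec"
    and f: "f \<in> closed_span (*s) S"
  shows "(\<lambda>z. A z *v f z) \<in> H2_vec"
proof -
  have fL: "f \<in> L2" using f closed_span_L2 by blast
  have "(\<lambda>z. (A z *v f z) $ i) \<in> H2" for i
  proof -
    have L: "(\<lambda>z. (A z *v f z) $ i) \<in> L2"
      by (simp add: matrix_vector_mult_def L2_sum Linf_mult_L2 Linf_mat_nth[OF A] L2_nth[OF fL])
    have "\<exists>C. AE z in arc_measure. norm (A z $ i $ j) \<le> C" for j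
      using Linf_mat_nth[OF A] by (auto simp: Linf_def)
    then obtain C where C: "\<And>j. AE z in arc_measure. norm (A z $ i $ j) \<le> C j" by metis
    then have allC: "AE z in arc_measure. \<forall>j. norm (A z $ i $ j) \<le> C j"
      by (simp add: AE_all_countable)
    have [measurable]: "(\<lambda>z. A z $ i $ j) \<in> borel_measurable borel" for j
      by (rule Linf_measurable[OF Linf_mat_nth[OF A]])
    have "(LINT z|arc_measure. (A z *v f z) $ i * z ^ k) = 0" if k: "k \<ge> 1" for k
    proof (rule closed_span_functional[OF bounded_linear_scale_vec S _ _ _ _ _ f,
          where a = "\<lambda>z v. (A z *v v) $ i * z ^ k" and C = "\<Sum>j\<in>UNIV. C j"])
      show "(\<lambda>z. (A z *v g z) $ i * z ^ k) \<in> borel_measurable borel"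
        if "g \<in> borel_measurable borel" for g :: "complex \<Rightarrow> complex ^ 'n"
      proof -
        note [measurable] = that
        have [measurable]: "(\<lambda>z. g z $ j) \<in> borel_measurable borel" for j
          by (rule borel_measurable_continuous_on[OF _ that]) (intro continuous_intros)
        show ?thesis unfolding matrix_vector_mult_def by simp
      qed
      show "linear (\<lambda>v. (A z *v v) $ i * z ^ k)" for z
        by (rule linearI)
          (simp_all add: matrix_vector_mult_def algebra_simps sum.distrib sum_distrib_left scaleR_sum_right)
      show "(A z *v (c *s v)) $ i * z ^ k = c * ((A z *v v) $ i * z ^ k)" for z c v
        by (simp add: matrix_vector_mult_def sum_distrib_left sum_distrib_right mult_ac)
      show "AE z in arc_measure. \<forall>v. norm ((A z *v v) $ i * z ^ k) \<le> (\<Sum>j\<in>UNIV. C j) * norm v"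
        using allC AE_arc_norm
      proof eventually_elim
        case (elim z)
        show ?case
        proof
          fix v :: "complex ^ 'n"
          have "norm ((A z *v v) $ i * z ^ k) = norm (\<Sum>j\<in>UNIV. A z $ i $ j * v $ j)"
            using elim by (simp add: matrix_vector_mult_def norm_mult norm_power)
          also have "\<dots> \<le> (\<Sum>j\<in>UNIV. C j * norm v)"
          proof (rule sum_norm_le)
            fix j
            show "norm (A z $ i $ j * v $ j) \<le> C j * norm v"
              using elim Finite_Cartesian_Product.norm_nth_le[of v j] by (auto simp: norm_mult intro!: mult_mono')
          qed
          finally show "norm ((A z *v v) $ i * z ^ k) \<le> (\<Sum>j\<in>UNIV. C j) * norm v"
            by (simp add: sum_distrib_right)
        qed
      qed
      show "(LINT z|arc_measure. (A z *v g z) $ i * z ^ k) = 0" if "g \<in> S" for g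
        using gen[OF that] k by (simp add: H2_vec_def H2_def)
    qed
    then show ?thesis using L by (simp add: H2_def)
  qed
  then show ?thesis by (simp add: H2_vec_def)
qed

lemma mult_axis_nth: "(A *v axis j 1) $ i = A $ i $ j" for A :: "complex ^ 'n ^ 'n"
  by (simp add: matrix_vector_mult_def axis_def if_distrib cong: if_cong)

lemma column_in_mat_range:
  fixes \<Gamma> :: "complex \<Rightarrow> complex ^ 'n ^ 'n"
  assumes \<Gamma>: "\<Gamma> \<in> Hinf_mat"
  shows "(\<lambda>z. \<Gamma> z *v axis j 1) \<in> mat_range \<Gamma>"
proof -
  have "(\<lambda>z. \<Gamma> z *v axis j 1) \<in> L2"
    by (rule L2_vecI) (use Hinf_mat_nth[OF \<Gamma>] in \<open>simp add: mult_axis_nth Hinf_iff H2_L2\<close>)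
  moreover have "(\<lambda>z. axis j 1 :: complex ^ 'n) \<in> H2_vec"
    by (simp add: H2_vec_def H2_const)
  ultimately show ?thesis unfolding mat_range_def by (auto intro!: bexI[of _ "\<lambda>z. axis j 1"])
qed

section \<open>Left greatest common divisors and analytic quotients\<close>

lemma mat_range_subset_left_gcd:
  assumes gcd: "is_left_gcd F \<Omega>" and \<Gamma>: "\<Gamma> \<in> F"
  shows "mat_range \<Gamma> \<subseteq> mat_range \<Omega>"
proof -
  have S: "(\<Union>\<Theta>\<in>F. mat_range \<Theta>) \<subseteq> L2" by (auto simp: mat_range_def)
  have "(\<Union>\<Theta>\<in>F. mat_range \<Theta>) \<subseteq> lin_span (*s) (\<Union>\<Theta>\<in>F. mat_range \<Theta>)"
    by (rule lin_span_superset) simp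
  also have "\<dots> \<subseteq> closed_span (*s) (\<Union>\<Theta>\<in>F. mat_range \<Theta>)"
    by (rule lin_span_closed_span[OF bounded_linear_scale_vec S])
  finally show ?thesis using gcd \<Gamma> by (auto simp: is_left_gcd_def)
qed

text \<open>The columns of \<open>\<Gamma>\<close> lie in the range of \<open>\<Omega>\<close>,
  which is the closed span of the ranges of the generators; \<open>A\<close> maps those ranges into
  \<open>H2_vec\<close>, hence also the columns.\<close>

lemma left_gcd_multiplier:
  fixes A \<Gamma> \<Omega> :: "complex \<Rightarrow> complex ^ 'n ^ 'n"
  assumes gcd: "is_left_gcd F \<Omega>" and A: "A \<in> Linf_mat"
    and gen: "\<And>\<Theta>. \<Theta> \<in> F \<Longrightarrow> (\<lambda>z. A z ** \<Theta> z) \<in> Hinf_mat"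
    and \<Gamma>: "\<Gamma> \<in> Hinf_mat" "mat_range \<Gamma> \<subseteq> mat_range \<Omega>"
  shows "(\<lambda>z. A z ** \<Gamma> z) \<in> Hinf_mat"
proof -
  define S where "S = (\<Union>\<Theta>\<in>F. mat_range \<Theta>)"
  have S: "S \<subseteq> L2" by (auto simp: S_def mat_range_def)
  have genS: "(\<lambda>z. A z *v g z) \<in> H2_vec" if gS: "g \<in> S" for g
  proof -
    obtain \<Theta> h where \<Theta>: "\<Theta> \<in> F" and g: "g \<in> L2" and h: "h \<in> H2_vec"
      and eq: "AE z in arc_measure. g z = \<Theta> z *v h z" using gS by (auto simp: S_def mat_range_def)
    have "(\<lambda>z. (A z *v g z) $ i) \<in> H2" for i
    proof (rule H2_cong_AE)
      show "(\<lambda>z. (A z *v g z) $ i) \<in> borel_measurable borel"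
        by (rule L2_measurable)
          (simp add: matrix_vector_mult_def L2_sum Linf_mult_L2 Linf_mat_nth[OF A] L2_nth[OF g])
      show "(\<lambda>z. \<Sum>j\<in>UNIV. (A z ** \<Theta> z) $ i $ j * h z $ j) \<in> H2"
        using h by (intro H2_sum Hinf_mult_H2 Hinf_mat_nth[OF gen[OF \<Theta>]]) (simp add: H2_vec_def)
      show "AE z in arc_measure. (A z *v g z) $ i = (\<Sum>j\<in>UNIV. (A z ** \<Theta> z) $ i $ j * h z $ j)"
        using eq
      proof eventually_elim
        case (elim z)
        then have "A z *v g z = (A z ** \<Theta> z) *v h z" by (simp add: matrix_vector_mul_assoc)
        then show ?case by (simp add: matrix_vector_mult_def)
      qed
    qed
    then show ?thesis by (simp add: H2_vec_def)
  qed
  have "(\<lambda>z. (A z ** \<Gamma> z) $ i $ j) \<in> Hinf" for i j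
  proof -
    have mem: "(\<lambda>z. \<Gamma> z *v axis j 1) \<in> closed_span (*s) S"
      using column_in_mat_range[OF \<Gamma>(1), of j] \<Gamma>(2) gcd by (auto simp: is_left_gcd_def S_def)
    have "(\<lambda>z. (A z *v (\<Gamma> z *v axis j 1)) $ i) \<in> H2"
      using closed_span_matrix_mult_H2[OF A S genS mem] by (simp add: H2_vec_def)
    moreover have "(A z *v (\<Gamma> z *v axis j 1)) $ i = (A z ** \<Gamma> z) $ i $ j" for z
      by (simp add: matrix_vector_mul_assoc mult_axis_nth)
    ultimately have "(\<lambda>z. (A z ** \<Gamma> z) $ i $ j) \<in> H2" by simp
    then show ?thesis
      using Linf_mat_nth[OF Linf_mat_mult[OF A Hinf_mat_Linf_mat[OF \<Gamma>(1)]]] by (simp add: Hinf_iff)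
  qed
  then show ?thesis by (simp add: Hinf_mat_def)
qed

text \<open>Inclusion of ranges is divisibility on the left: the cofactor of each column is
  analytic, and unitarity identifies it with the column of
  \<open>adjoint_mat (\<Omega> z) ** \<Gamma> z\<close>.\<close>

lemma mat_range_subset_quotient:
  fixes \<Gamma> \<Omega> :: "complex \<Rightarrow> complex ^ 'n ^ 'n"
  assumes \<Omega>: "two_sided_inner \<Omega>" and \<Gamma>: "\<Gamma> \<in> Hinf_mat" "mat_range \<Gamma> \<subseteq> mat_range \<Omega>"
  shows "(\<lambda>z. adjoint_mat (\<Omega> z) ** \<Gamma> z) \<in> Hinf_mat"
proof -
  have unit: "AE z in arc_measure. unitary_mat (\<Omega> z)" and \<Omega>H: "\<Omega> \<in> Hinf_mat"
    using \<Omega> by (simp_all add: two_sided_inner_def)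
  have L: "(\<lambda>z. adjoint_mat (\<Omega> z) ** \<Gamma> z) \<in> Linf_mat"
    by (intro Linf_mat_mult Linf_mat_adjoint Hinf_mat_Linf_mat \<Omega>H \<Gamma>)
  have "(\<lambda>z. (adjoint_mat (\<Omega> z) ** \<Gamma> z) $ i $ j) \<in> Hinf" for i j
  proof -
    obtain h where h: "h \<in> H2_vec" and eq: "AE z in arc_measure. \<Gamma> z *v axis j 1 = \<Omega> z *v h z"
      using column_in_mat_range[OF \<Gamma>(1), of j] \<Gamma>(2) by (auto simp: mat_range_def)
    have "(\<lambda>z. (adjoint_mat (\<Omega> z) ** \<Gamma> z) $ i $ j) \<in> H2"
    proof (rule H2_cong_AE[OF Linf_measurable[OF Linf_mat_nth[OF L]]])
      show "(\<lambda>z. h z $ i) \<in> H2" using h by (simp add: H2_vec_def)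
      show "AE z in arc_measure. (adjoint_mat (\<Omega> z) ** \<Gamma> z) $ i $ j = h z $ i"
        using eq unit
      proof eventually_elim
        case (elim z)
        have "(adjoint_mat (\<Omega> z) ** \<Gamma> z) $ i $ j = (adjoint_mat (\<Omega> z) *v (\<Gamma> z *v axis j 1)) $ i"
          by (simp add: matrix_vector_mul_assoc mult_axis_nth)
        also have "\<dots> = h z $ i"
          using elim by (simp add: matrix_vector_mul_assoc unitary_mat_def)
        finally show ?case .
      qed
    qed
    then show ?thesis using Linf_mat_nth[OF L] by (simp add: Hinf_iff)
  qed
  then show ?thesis by (simp add: Hinf_mat_def)
qed

text \<open>Unitarity forces the cofactor of any scalar inner multiple \<open>\<theta>\<close> to be
  \<open>\<theta>\<Delta>\<^sup>*\<close>. Each entry of \<open>\<Delta>\<^sup>*\<close> is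
  therefore a multiplier that makes all these \<open>\<theta>\<close> analytic, and then also their
  g.c.d. \<open>\<delta>\<close>.\<close>

lemma minimal_scalar_inner_multiple_is_multiple:
  assumes \<Delta>: "two_sided_inner \<Delta>" and \<delta>: "is_minimal_scalar_inner_multiple \<Delta> \<delta>"
  shows "(\<lambda>z. mat (\<delta> z) ** adjoint_mat (\<Delta> z)) \<in> Hinf_mat"
proof -
  have \<Delta>H: "\<Delta> \<in> Hinf_mat" and unit: "AE z in arc_measure. unitary_mat (\<Delta> z)"
    using \<Delta> by (auto simp: two_sided_inner_def)
  have adj: "(\<lambda>z. adjoint_mat (\<Delta> z)) \<in> Linf_mat"
    by (rule Linf_mat_adjoint[OF Hinf_mat_Linf_mat[OF \<Delta>H]])
  have "(\<lambda>z. adjoint_mat (\<Delta> z) $ i $ j * \<delta> z) \<in> Hinf" for i j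
  proof (rule gcd_multiplier[OF \<delta>[unfolded is_minimal_scalar_inner_multiple_def] _ Linf_mat_nth[OF adj]])
    fix \<theta> assume "\<theta> \<in> {\<theta>. scalar_inner_multiple \<theta> \<Delta>}"
    then obtain \<Gamma> where \<theta>: "scalar_inner \<theta>" and \<Gamma>: "\<Gamma> \<in> Hinf_mat"
      and eq: "AE z in arc_measure. \<Delta> z ** \<Gamma> z = mat (\<theta> z)"
      by (auto simp: scalar_inner_multiple_def elim!: eventually_mono)
    show "scalar_inner \<theta>" by (rule \<theta>)
    have "(\<lambda>z. mat (\<theta> z) ** adjoint_mat (\<Delta> z)) \<in> Hinf_mat"
    proof (rule Hinf_mat_cong_AE[OF Linf_mat_scale[OF scalar_inner_Linf[OF \<theta>] adj] \<Gamma>])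
      show "AE z in arc_measure. mat (\<theta> z) ** adjoint_mat (\<Delta> z) = \<Gamma> z"
        using eq unit
      proof eventually_elim
        case (elim z)
        have "mat (\<theta> z) ** adjoint_mat (\<Delta> z) = adjoint_mat (\<Delta> z) ** (\<Delta> z ** \<Gamma> z)"
          by (simp add: elim(1) mult_mat_commute)
        also have "\<dots> = \<Gamma> z" using elim(2) by (simp add: matrix_mul_assoc unitary_mat_def)
        finally show ?case .
      qed
    qed
    from Hinf_mat_nth[OF this] show "(\<lambda>z. adjoint_mat (\<Delta> z) $ i $ j * \<theta> z) \<in> Hinf"
      by (simp add: mat_mult_nth mult.commute)
  qed
  then show ?thesis by (simp add: Hinf_mat_def mat_mult_nth mult.commute)
qed

text \<open>Entry \<open>(i, j)\<close> of the first function is the conjugate of entry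
  \<open>(j, i)\<close> of the second, so each entry is analytic together with its conjugate and
  hence constant.\<close>

lemma constant_unitary_factor:
  assumes \<Omega>: "two_sided_inner \<Omega>" and \<omega>: "scalar_inner \<omega>"
    and 1: "(\<lambda>z. mat (cnj (\<omega> z)) ** \<Omega> z) \<in> Hinf_mat"
    and 2: "(\<lambda>z. mat (\<omega> z) ** adjoint_mat (\<Omega> z)) \<in> Hinf_mat"
  shows "\<exists>U. unitary_mat U \<and> (AE z in arc_measure. \<Omega> z = mat (\<omega> z) ** U)"
proof -
  have "\<exists>c. AE z in arc_measure. cnj (\<omega> z) * \<Omega> z $ i $ j = c" for i j
    using Hinf_mat_nth[OF 1, of i j] Hinf_mat_nth[OF 2, of j i]
    by (intro H2_cnj_H2_constant) (simp_all add: mat_mult_nth adjoint_mat_nth Hinf_iff)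
  then obtain c where c: "\<And>i j. AE z in arc_measure. cnj (\<omega> z) * \<Omega> z $ i $ j = c i j" by metis
  define U where "U = (\<chi> i j. c i j)"
  have "AE z in arc_measure. \<forall>i j. cnj (\<omega> z) * \<Omega> z $ i $ j = c i j"
    using c by (simp add: AE_all_countable)
  then have U: "AE z in arc_measure. mat (cnj (\<omega> z)) ** \<Omega> z = U"
    by eventually_elim (simp add: vec_eq_iff mat_mult_nth U_def)
  have "AE z in arc_measure. unitary_mat (\<Omega> z)" using \<Omega> by (simp add: two_sided_inner_def)
  with U scalar_inner_mult_cnj[OF \<omega>] have "AE z in arc_measure. unitary_mat U"
  proof eventually_elim
    case (elim z)
    then show ?case using unitary_mat_scale[of "\<Omega> z" "cnj (\<omega> z)"] by (simp add: mult.commute)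
  qed
  moreover have "AE z in arc_measure. \<Omega> z = mat (\<omega> z) ** U"
    using U scalar_inner_mult_cnj[OF \<omega>]
  proof eventually_elim
    case (elim z)
    have "mat (\<omega> z) ** U = mat (\<omega> z * cnj (\<omega> z)) ** \<Omega> z"
      by (simp only: elim(1)[symmetric] matrix_mul_assoc mat_mult_mat)
    then show ?case by (simp add: elim(2))
  qed
  ultimately show ?thesis by auto
qed

theorem theorem1:
  fixes \<Delta>\<^sub>1 \<Delta>\<^sub>2 \<Omega> :: "complex \<Rightarrow> complex ^ 'n ^ 'n"
    and \<delta> \<theta> :: "complex \<Rightarrow> complex"
  assumes "two_sided_inner \<Delta>\<^sub>1" and "two_sided_inner \<Delta>\<^sub>2"
    and "no_nonconstant_scalar_inner_factors \<Delta>\<^sub>1"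
    and "no_nonconstant_scalar_inner_factors \<Delta>\<^sub>2"
    and "scalar_inner \<delta>"
    and "is_minimal_scalar_inner_multiple \<Delta>\<^sub>1 \<delta>"
    and "is_minimal_scalar_inner_multiple \<Delta>\<^sub>2 \<delta>"
    and "scalar_inner \<theta>"
    and "is_left_gcd {\<lambda>z. mat (\<theta> z), \<lambda>z. \<Delta>\<^sub>1 z ** \<Delta>\<^sub>2 z} \<Omega>"
    and "is_left_gcd {\<lambda>z. mat (\<theta> z), \<lambda>z. mat (\<delta> z) ** \<Delta>\<^sub>1 z} \<Omega>"
  shows "\<exists>\<omega> U. scalar_inner \<omega> \<and> unitary_mat U
           \<and> (AE z in arc_measure. \<Omega> z = mat (\<omega> z) ** U)
           \<and> is_gcd {\<theta>, \<delta>} \<omega>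
           \<and> coprime_inner (\<lambda>z. cnj (\<omega> z) * \<theta> z) \<delta>"
proof -
  note \<delta> = assms(5) and \<theta> = assms(8) and gcd1 = assms(9) and gcd2 = assms(10)
  have \<Delta>1: "\<Delta>\<^sub>1 \<in> Hinf_mat" "AE z in arc_measure. unitary_mat (\<Delta>\<^sub>1 z)" and \<Delta>2: "\<Delta>\<^sub>2 \<in> Hinf_mat"
    using assms(1,2) by (auto simp: two_sided_inner_def)
  have \<Omega>: "two_sided_inner \<Omega>" "\<Omega> \<in> Hinf_mat" "AE z in arc_measure. unitary_mat (\<Omega> z)"
    using gcd1 by (auto simp: is_left_gcd_def two_sided_inner_def)
  have \<Gamma>: "(\<lambda>z. mat (\<delta> z) ** adjoint_mat (\<Delta>\<^sub>1 z)) \<in> Hinf_mat"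
    by (rule minimal_scalar_inner_multiple_is_multiple[OF assms(1,6)])
  have \<Delta>1adj: "(\<lambda>z. adjoint_mat (\<Delta>\<^sub>1 z)) \<in> Linf_mat"
    by (intro Linf_mat_adjoint Hinf_mat_Linf_mat \<Delta>1)
  have \<delta>H: "\<delta> \<in> Hinf" and \<theta>H: "\<theta> \<in> Hinf" using \<delta> \<theta> by (simp_all add: scalar_inner_Hinf)

  have S: "\<eta> \<in> {\<theta>, \<delta>} \<Longrightarrow> scalar_inner \<eta>" for \<eta> using \<theta> \<delta> by auto
  obtain \<omega> where \<omega>gcd: "is_gcd {\<theta>, \<delta>} \<omega>" using gcd_exists[OF S] by blast
  then have \<omega>: "scalar_inner \<omega>" by (simp add: is_gcd_def)
  have \<omega>L: "\<omega> \<in> Linf" "(\<lambda>z. cnj (\<omega> z)) \<in> Linf" using \<omega> by (simp_all add: scalar_inner_Linf Linf_cnj)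
  define \<theta>' where "\<theta>' z = cnj (\<omega> z) * \<theta> z" for z
  define \<delta>' where "\<delta>' z = cnj (\<omega> z) * \<delta> z" for z
  have \<theta>'H: "\<theta>' \<in> Hinf" and \<delta>'H: "\<delta>' \<in> Hinf"
    unfolding \<theta>'_def[abs_def] \<delta>'_def[abs_def] by (rule gcd_divides[OF \<omega>gcd S]; simp)+
  have \<theta>': "scalar_inner \<theta>'"
    using \<theta>'H \<omega> \<theta> by (auto simp: scalar_inner_def \<theta>'_def norm_mult)

  \<comment> \<open>The g.c.d. is taken with \<open>\<delta>\<close> and not with
    \<open>\<delta>'\<close>: the latter would be trivial, and the square of \<open>\<delta>\<close>
    met at the end requires the former.\<close>
  have S': "\<eta> \<in> {\<theta>', \<delta>} \<Longrightarrow> scalar_inner \<eta>" for \<eta> using \<theta>' \<delta> by auto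
  obtain \<sigma> where \<sigma>gcd: "is_gcd {\<theta>', \<delta>} \<sigma>" using gcd_exists[OF S'] by blast
  then have \<sigma>: "scalar_inner \<sigma>" by (simp add: is_gcd_def)
  have \<sigma>L: "(\<lambda>z. cnj (\<sigma> z)) \<in> Linf" using \<sigma> by (simp add: scalar_inner_Linf Linf_cnj)
  define \<theta>'' where "\<theta>'' z = cnj (\<sigma> z) * \<theta>' z" for z
  define \<delta>'' where "\<delta>'' z = cnj (\<sigma> z) * \<delta> z" for z
  have \<theta>''H: "\<theta>'' \<in> Hinf" and \<delta>''H: "\<delta>'' \<in> Hinf"
    unfolding \<theta>''_def[abs_def] \<delta>''_def[abs_def] by (rule gcd_divides[OF \<sigma>gcd S']; simp)+

  define b where "b z = cnj (\<omega> z) * cnj (\<sigma> z)" for z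
  have bL: "b \<in> Linf" unfolding b_def[abs_def] by (intro Linf_mult \<omega>L \<sigma>L)
  define A where "A z = mat (b z) ** (mat (\<delta> z) ** adjoint_mat (\<Delta>\<^sub>1 z))" for z
  have AL: "A \<in> Linf_mat"
    unfolding A_def[abs_def] by (intro Linf_mat_scale bL Hinf_mat_Linf_mat \<Gamma>)
  have "(\<lambda>z. A z ** (\<Delta>\<^sub>1 z ** \<Delta>\<^sub>2 z)) \<in> Hinf_mat"
  proof (rule left_gcd_multiplier[OF gcd2 AL])
    fix \<Theta> :: "complex \<Rightarrow> complex ^ 'n ^ 'n"
    assume "\<Theta> \<in> {\<lambda>z. mat (\<theta> z), \<lambda>z. mat (\<delta> z) ** \<Delta>\<^sub>1 z}"
    then consider "\<Theta> = (\<lambda>z. mat (\<theta> z))" | "\<Theta> = (\<lambda>z. mat (\<delta> z) ** \<Delta>\<^sub>1 z)" by blast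
    then show "(\<lambda>z. A z ** \<Theta> z) \<in> Hinf_mat"
    proof cases
      case 1
      have "A z ** mat (\<theta> z) = mat (\<theta>'' z) ** (mat (\<delta> z) ** adjoint_mat (\<Delta>\<^sub>1 z))" for z
      proof -
        have "A z ** mat (\<theta> z) = mat (\<theta> z) ** A z" by (rule mult_mat_commute)
        also have "\<dots> = mat (\<theta> z * b z) ** (mat (\<delta> z) ** adjoint_mat (\<Delta>\<^sub>1 z))"
          by (simp only: A_def matrix_mul_assoc mat_mult_mat mult.assoc)
        also have "\<theta> z * b z = \<theta>'' z" by (simp add: b_def \<theta>''_def \<theta>'_def)
        finally show ?thesis .
      qed
      then show ?thesis using Hinf_mat_scale[OF \<theta>''H \<Gamma>] by (simp only: 1)
    next
      \<comment> \<open>The two copies of \<open>\<delta>\<close>, one from \<open>A\<close> and one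
        from the generator, are divided separately: one by \<open>\<omega>\<close>, the other by
        \<open>\<sigma>\<close>.\<close>
      case 2
      have "(\<lambda>z. mat (\<delta>' z * \<delta>'' z)) \<in> (Hinf_mat :: (complex \<Rightarrow> complex ^ 'n ^ 'n) set)"
        by (intro Hinf_mat_mat Hinf_mult \<delta>'H \<delta>''H)
      then show ?thesis
      proof (rule Hinf_mat_cong_AE[rotated])
        show "(\<lambda>z. A z ** \<Theta> z) \<in> Linf_mat"
          unfolding 2 by (intro Linf_mat_mult[OF AL] Linf_mat_scale scalar_inner_Linf \<delta> Hinf_mat_Linf_mat \<Delta>1)
        show "AE z in arc_measure. A z ** \<Theta> z = mat (\<delta>' z * \<delta>'' z)"
          using \<Delta>1(2)
        proof eventually_elim
          case (elim z)
          have "A z ** \<Theta> z = mat (b z * \<delta> z) ** ((adjoint_mat (\<Delta>\<^sub>1 z) ** mat (\<delta> z)) ** \<Delta>\<^sub>1 z)"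
            by (simp only: 2 A_def matrix_mul_assoc mat_mult_mat)
          also have "\<dots> = mat (b z * \<delta> z) ** mat (\<delta> z) ** (adjoint_mat (\<Delta>\<^sub>1 z) ** \<Delta>\<^sub>1 z)"
            by (simp only: mult_mat_commute[of "adjoint_mat (\<Delta>\<^sub>1 z)"]) (simp only: matrix_mul_assoc)
          also have "\<dots> = mat (\<delta>' z * \<delta>'' z)"
            using elim by (simp add: unitary_mat_def mat_mult_mat \<delta>'_def \<delta>''_def b_def mult_ac)
          finally show ?case .
        qed
      qed
    qed
  next
    show "(\<lambda>z. \<Delta>\<^sub>1 z ** \<Delta>\<^sub>2 z) \<in> Hinf_mat" by (rule Hinf_mat_mult[OF \<Delta>1(1) \<Delta>2])
    show "mat_range (\<lambda>z. \<Delta>\<^sub>1 z ** \<Delta>\<^sub>2 z) \<subseteq> mat_range \<Omega>"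
      by (rule mat_range_subset_left_gcd[OF gcd1]) simp
  qed
  then have b\<delta>\<Delta>2: "(\<lambda>z. mat (b z * \<delta> z) ** \<Delta>\<^sub>2 z) \<in> Hinf_mat"
  proof (rule Hinf_mat_cong_AE[rotated])
    show "(\<lambda>z. mat (b z * \<delta> z) ** \<Delta>\<^sub>2 z) \<in> Linf_mat"
      by (intro Linf_mat_scale Linf_mult bL scalar_inner_Linf \<delta> Hinf_mat_Linf_mat \<Delta>2)
    show "AE z in arc_measure. mat (b z * \<delta> z) ** \<Delta>\<^sub>2 z = A z ** (\<Delta>\<^sub>1 z ** \<Delta>\<^sub>2 z)"
      using \<Delta>1(2)
    proof eventually_elim
      case (elim z)
      have "A z ** (\<Delta>\<^sub>1 z ** \<Delta>\<^sub>2 z) = mat (b z * \<delta> z) ** (adjoint_mat (\<Delta>\<^sub>1 z) ** \<Delta>\<^sub>1 z) ** \<Delta>\<^sub>2 z"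
        by (simp only: A_def matrix_mul_assoc mat_mult_mat)
      then show ?case using elim by (simp add: unitary_mat_def)
    qed
  qed
  \<comment> \<open>An entry of \<open>\<Delta>\<^sub>2\<close> times \<open>b\<close> becomes
    analytic after multiplication by \<open>\<theta>\<close>, because
    \<open>\<omega>\<sigma>\<close> divides \<open>\<theta>\<close>, and by \<open>\<delta>\<close>,
    as just shown; hence also by \<open>\<omega>\<close>, which cancels the conjugate of
    \<open>\<omega>\<close> in \<open>b\<close>.\<close>
  have "(\<lambda>z. cnj (\<sigma> z) * \<Delta>\<^sub>2 z $ i $ j) \<in> Hinf" for i j
  proof -
    have x: "(\<lambda>z. \<Delta>\<^sub>2 z $ i $ j) \<in> Hinf" by (rule Hinf_mat_nth[OF \<Delta>2])
    have xL: "(\<lambda>z. \<Delta>\<^sub>2 z $ i $ j) \<in> Linf" using x by (simp add: Hinf_iff)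
    have mL: "(\<lambda>z. b z * \<Delta>\<^sub>2 z $ i $ j) \<in> Linf" by (intro Linf_mult bL xL)
    have "(\<lambda>z. b z * \<Delta>\<^sub>2 z $ i $ j * \<omega> z) \<in> Hinf"
    proof (rule gcd_multiplier[OF \<omega>gcd S mL])
      fix \<eta> assume "\<eta> \<in> {\<theta>, \<delta>}"
      then show "(\<lambda>z. b z * \<Delta>\<^sub>2 z $ i $ j * \<eta> z) \<in> Hinf"
        using Hinf_mult[OF \<theta>''H x] Hinf_mat_nth[OF b\<delta>\<Delta>2, of i j]
        by (auto simp: \<theta>''_def \<theta>'_def b_def mat_mult_nth mult_ac)
    qed
    then show ?thesis
    proof (rule Hinf_cong_AE[OF Linf_measurable[OF Linf_mult[OF \<sigma>L xL]]])
      show "AE z in arc_measure. cnj (\<sigma> z) * \<Delta>\<^sub>2 z $ i $ j = b z * \<Delta>\<^sub>2 z $ i $ j * \<omega> z"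
        using scalar_inner_mult_cnj[OF \<omega>]
      proof eventually_elim
        case (elim z)
        have "b z * \<Delta>\<^sub>2 z $ i $ j * \<omega> z = (\<omega> z * cnj (\<omega> z)) * (cnj (\<sigma> z) * \<Delta>\<^sub>2 z $ i $ j)"
          by (simp add: b_def mult_ac)
        then show ?case by (simp only: elim mult_1_left)
      qed
    qed
  qed
  then have "(\<lambda>z. mat (cnj (\<sigma> z)) ** \<Delta>\<^sub>2 z) \<in> Hinf_mat" by (simp add: Hinf_mat_def mat_mult_nth)
  moreover have "AE z in arc_measure. \<Delta>\<^sub>2 z = mat (\<sigma> z) ** (mat (cnj (\<sigma> z)) ** \<Delta>\<^sub>2 z)"
    using scalar_inner_mult_cnj[OF \<sigma>] by eventually_elim (simp add: matrix_mul_assoc mat_mult_mat)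
  ultimately have "scalar_inner_factor \<sigma> \<Delta>\<^sub>2"
    using \<sigma> by (auto simp: scalar_inner_factor_def)
  then obtain c where c: "AE z in arc_measure. \<sigma> z = c"
    using assms(4) by (auto simp: no_nonconstant_scalar_inner_factors_def)
  then have "AE z in arc_measure. c * cnj c = 1"
    using scalar_inner_mult_cnj[OF \<sigma>] by eventually_elim simp
  then have cc: "c * cnj c = 1" by simp
  \<comment> \<open>A unimodular constant does not change the range, so \<open>\<sigma>\<close> may
    be replaced by 1 as a g.c.d.\<close>
  have "scalar_range \<sigma> = scalar_range (\<lambda>z. 1)"
  proof -
    have "(\<lambda>z. cnj (\<sigma> z) * f z) \<in> H2 \<longleftrightarrow> f \<in> H2" if f: "f \<in> L2" for f
    proof
      note [measurable] = L2_measurable[OF f] Linf_measurable[OF scalar_inner_Linf[OF \<sigma>]]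
      assume "(\<lambda>z. cnj (\<sigma> z) * f z) \<in> H2"
      then have "(\<lambda>z. c * (cnj (\<sigma> z) * f z)) \<in> H2" by (rule H2_cmult)
      then show "f \<in> H2"
      proof (rule H2_cong_AE[rotated])
        show "AE z in arc_measure. f z = c * (cnj (\<sigma> z) * f z)"
          using c by eventually_elim (simp add: cc mult.assoc[symmetric])
      qed measurable
    next
      note [measurable] = L2_measurable[OF f] Linf_measurable[OF scalar_inner_Linf[OF \<sigma>]]
      assume "f \<in> H2"
      then have "(\<lambda>z. cnj c * f z) \<in> H2" by (rule H2_cmult)
      then show "(\<lambda>z. cnj (\<sigma> z) * f z) \<in> H2"
      proof (rule H2_cong_AE[rotated])
        show "AE z in arc_measure. cnj (\<sigma> z) * f z = cnj c * f z" using c by eventually_elim simp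
      qed measurable
    qed
    then show ?thesis by (auto simp: scalar_range_iff[OF \<sigma>] scalar_range_iff[OF scalar_inner_one])
  qed
  then have gcd_one: "is_gcd {\<theta>', \<delta>} (\<lambda>z. 1)"
    using \<sigma>gcd scalar_inner_one by (simp add: is_gcd_def)

  \<comment> \<open>Since \<open>\<omega>\<close> divides both \<open>\<theta>\<close> and
    \<open>\<delta>\<close>, it divides both generators, and therefore
    \<open>\<Omega>\<close>.\<close>
  have "(\<lambda>z. mat (cnj (\<omega> z)) ** \<Omega> z) \<in> Hinf_mat"
  proof (rule left_gcd_multiplier[OF gcd2 Linf_mat_mat[OF \<omega>L(2)] _ \<Omega>(2) order_refl])
    fix \<Theta> :: "complex \<Rightarrow> complex ^ 'n ^ 'n"
    assume "\<Theta> \<in> {\<lambda>z. mat (\<theta> z), \<lambda>z. mat (\<delta> z) ** \<Delta>\<^sub>1 z}"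
    then show "(\<lambda>z. mat (cnj (\<omega> z)) ** \<Theta> z) \<in> Hinf_mat"
      using Hinf_mat_mat[OF \<theta>'H] Hinf_mat_scale[OF \<delta>'H \<Delta>1(1)]
      by (auto simp: mat_mult_mat matrix_mul_assoc \<theta>'_def \<delta>'_def)
  qed
  moreover have "(\<lambda>z. mat (\<omega> z) ** adjoint_mat (\<Omega> z)) \<in> Hinf_mat"
  proof -
    have \<Omega>adj: "(\<lambda>z. adjoint_mat (\<Omega> z)) \<in> Linf_mat"
      by (intro Linf_mat_adjoint Hinf_mat_Linf_mat \<Omega>)
    have \<Omega>\<theta>: "(\<lambda>z. adjoint_mat (\<Omega> z) ** mat (\<theta> z)) \<in> Hinf_mat"
      by (rule mat_range_subset_quotient[OF \<Omega>(1) Hinf_mat_mat[OF \<theta>H] mat_range_subset_left_gcd[OF gcd2]]) simp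
    have \<Omega>\<delta>\<Delta>1: "(\<lambda>z. adjoint_mat (\<Omega> z) ** (mat (\<delta> z) ** \<Delta>\<^sub>1 z)) \<in> Hinf_mat"
      by (rule mat_range_subset_quotient[OF \<Omega>(1) Hinf_mat_scale[OF \<delta>H \<Delta>1(1)] mat_range_subset_left_gcd[OF gcd2]])
        simp
    \<comment> \<open>Multiplying \<open>\<delta>\<Delta>\<^sub>1\<close> on the right by the
      analytic \<open>\<delta>\<Delta>\<^sub>1\<^sup>*\<close> yields a scalar matrix, at the price
      of a second factor \<open>\<delta>\<close>.\<close>
    have \<Omega>\<delta>\<delta>: "(\<lambda>z. adjoint_mat (\<Omega> z) ** mat (\<delta> z * \<delta> z)) \<in> Hinf_mat"
    proof (rule Hinf_mat_cong_AE[OF _ Hinf_mat_mult[OF \<Omega>\<delta>\<Delta>1 \<Gamma>]])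
      show "(\<lambda>z. adjoint_mat (\<Omega> z) ** mat (\<delta> z * \<delta> z)) \<in> Linf_mat"
        by (intro Linf_mat_mult \<Omega>adj Linf_mat_mat Linf_mult scalar_inner_Linf \<delta>)
      show "AE z in arc_measure. adjoint_mat (\<Omega> z) ** mat (\<delta> z * \<delta> z)
        = adjoint_mat (\<Omega> z) ** (mat (\<delta> z) ** \<Delta>\<^sub>1 z) ** (mat (\<delta> z) ** adjoint_mat (\<Delta>\<^sub>1 z))"
        using \<Delta>1(2)
      proof eventually_elim
        case (elim z)
        have "(mat (\<delta> z) ** \<Delta>\<^sub>1 z) ** (mat (\<delta> z) ** adjoint_mat (\<Delta>\<^sub>1 z))
          = mat (\<delta> z) ** (\<Delta>\<^sub>1 z ** mat (\<delta> z)) ** adjoint_mat (\<Delta>\<^sub>1 z)"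
          by (simp only: matrix_mul_assoc)
        also have "\<dots> = mat (\<delta> z) ** (mat (\<delta> z) ** \<Delta>\<^sub>1 z) ** adjoint_mat (\<Delta>\<^sub>1 z)"
          by (simp only: mult_mat_commute[of "\<Delta>\<^sub>1 z"])
        also have "\<dots> = mat (\<delta> z * \<delta> z) ** (\<Delta>\<^sub>1 z ** adjoint_mat (\<Delta>\<^sub>1 z))"
          by (simp only: matrix_mul_assoc mat_mult_mat)
        finally show ?case using elim by (simp add: unitary_mat_def matrix_mul_assoc[symmetric])
      qed
    qed
    have "(\<lambda>z. adjoint_mat (\<Omega> z) $ i $ j * \<omega> z) \<in> Hinf" for i j
    proof -
      define y where "y z = adjoint_mat (\<Omega> z) $ i $ j" for z
      have yL: "y \<in> Linf" unfolding y_def[abs_def] by (rule Linf_mat_nth[OF \<Omega>adj])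
      have y\<theta>: "(\<lambda>z. y z * \<theta> z) \<in> Hinf" and y\<delta>\<delta>: "(\<lambda>z. y z * (\<delta> z * \<delta> z)) \<in> Hinf"
        using Hinf_mat_nth[OF \<Omega>\<theta>, of i j] Hinf_mat_nth[OF \<Omega>\<delta>\<delta>, of i j] by (simp_all add: mult_mat_nth y_def)
      \<comment> \<open>First reduction: with multiplier \<open>y \<delta>\<close>, the g.c.d. of
        \<open>\<theta>\<close> and \<open>\<delta>\<close> trades one factor of the square of
        \<open>\<delta>\<close> for \<open>\<omega>\<close>.\<close>
      have y\<delta>\<omega>: "(\<lambda>z. y z * \<delta> z * \<omega> z) \<in> Hinf"
      proof (rule gcd_multiplier[OF \<omega>gcd S Linf_mult[OF yL scalar_inner_Linf[OF \<delta>]]])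
        fix \<eta> assume "\<eta> \<in> {\<theta>, \<delta>}"
        then show "(\<lambda>z. y z * \<delta> z * \<eta> z) \<in> Hinf"
          using Hinf_mult[OF y\<theta> \<delta>H] y\<delta>\<delta> by (auto simp: mult_ac)
      qed
      have y\<omega>L: "(\<lambda>z. y z * \<omega> z) \<in> Linf" by (rule Linf_mult[OF yL \<omega>L(1)])
      \<comment> \<open>Second reduction: with multiplier \<open>y \<omega>\<close>, coprimality of
        \<open>\<theta>'\<close> and \<open>\<delta>\<close> removes the remaining
        \<open>\<delta>\<close>. The factor 1 is the g.c.d. itself.\<close>
      have "(\<lambda>z. y z * \<omega> z * 1) \<in> Hinf"
      proof (rule gcd_multiplier[OF gcd_one S' y\<omega>L])
        fix \<eta> assume "\<eta> \<in> {\<theta>', \<delta>}"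
        moreover have "(\<lambda>z. y z * \<omega> z * \<theta>' z) \<in> Hinf"
        proof (rule Hinf_cong_AE[OF _ y\<theta>])
          show "(\<lambda>z. y z * \<omega> z * \<theta>' z) \<in> borel_measurable borel"
            by (intro Linf_measurable Linf_mult y\<omega>L scalar_inner_Linf \<theta>')
          show "AE z in arc_measure. y z * \<omega> z * \<theta>' z = y z * \<theta> z"
            using scalar_inner_mult_cnj[OF \<omega>]
          proof eventually_elim
            case (elim z)
            have "y z * \<omega> z * \<theta>' z = (\<omega> z * cnj (\<omega> z)) * (y z * \<theta> z)" by (simp add: \<theta>'_def mult_ac)
            then show ?case by (simp only: elim mult_1_left)
          qed
        qed
        moreover have "(\<lambda>z. y z * \<omega> z * \<delta> z) \<in> Hinf" using y\<delta>\<omega> by (simp add: mult_ac)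
        ultimately show "(\<lambda>z. y z * \<omega> z * \<eta> z) \<in> Hinf" by auto
      qed
      then show ?thesis by (simp add: y_def)
    qed
    then show ?thesis by (simp add: Hinf_mat_def mat_mult_nth mult.commute)
  qed
  ultimately obtain U where "unitary_mat U" "AE z in arc_measure. \<Omega> z = mat (\<omega> z) ** U"
    using constant_unitary_factor[OF \<Omega>(1) \<omega>] by blast
  moreover have "coprime_inner (\<lambda>z. cnj (\<omega> z) * \<theta> z) \<delta>"
    using gcd_one \<theta>' \<delta> by (simp add: coprime_inner_def \<theta>'_def[abs_def])
  ultimately show ?thesis using \<omega> \<omega>gcd by blast
qed

end
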